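(* For $|q|<1$ and every real $\nu$, \begin{align*} \sum_{i,j,k\geq 0} \frac{q^{i^2+j^2+k^2+ij+ik+\nu(j-k)}}{(q;q)_i(q;q)_j(q;q)_k} &=\frac{(-q^{1+\nu},-q^{1-\nu},q^2;q^2)_\infty}{(q;q)_\infty}, \\ \sum_{i,j,k\geq 0}\frac{q^{i^2+j^2+k^2+ij+ik+i+j}}{(q;q)_i(q;q)_j(q;q)_k}&=\frac{(q^4;q^4)_\infty^2}{(q;q)_\infty (q^2;q^2)_\infty}, \\ \sum_{i,j,k\geq 0}\frac{q^{2i^2+2j^2+2k^2+2ij+2ik+i+2k}}{(q^2;q^2)_i(q^2;q^2)_j(q^2;q^2)_k}&=\frac{(q,q^5,q^6;q^6)_\infty}{(q;q)_\infty}, \\ \sum_{i,j,k\geq 0}\frac{q^{2i^2+2j^2+2k^2+2ij+2ik-i}}{(q^2;q^2)_i(q^2;q^2)_j(q^2;q^2)_k}&=\frac{(q^3;q^3)_\infty^2}{(q;q)_\infty (q^6;q^6)_\infty},\\ \sum_{i,j,k\geq 0}\frac{q^{2i^2+2j^2+2k^2+2ij+2ik-2i-j-k}}{(q^2;q^2)_i(q^2;q^2)_j(q^2;q^2)_k}&=2\frac{(q^2;q^2)_\infty}{(q;q)_\infty}. \end{align*}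
   Context: For $|q|<1$: $(a;q)_n=\prod_{k=0}^{n-1}(1-aq^k)$ ($(a;q)_0=1$), $(a;q)_\infty=\prod_{k\ge0}(1-aq^k)$, $(a_1,\dots,a_m;q)_\infty=\prod_\ell(a_\ell;q)_\infty$. Real powers $q^{x}$ are defined as $e^{x\log q}$ for a fixed choice of $\log q$ (e.g. $0<q<1$). *)

theory Defs
  imports "HOL-Analysis.Analysis"
begin

definition qpoch :: "complex \<Rightarrow> complex \<Rightarrow> nat \<Rightarrow> complex" where
  "qpoch a q n = (\<Prod>k<n. 1 - a * q ^ k)"

definition qpoch_inf :: "complex \<Rightarrow> complex \<Rightarrow> complex" where
  "qpoch_inf a q = (\<Prod>k. 1 - a * q ^ k)"

text \<open>Real power q^x := exp(x * L), where L is a fixed logarithm of q (exp L = q).\<close>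
definition qpow :: "complex \<Rightarrow> real \<Rightarrow> complex" where
  "qpow L x = exp (of_real x * L)"

end

theory Submission
  imports Defs
begin

text \<open>
  All sums run over integer indices, with \<open>1 / (q; q)_n\<close> read as 0 for \<open>n < 0\<close>, so that reindexing is a
  linear substitution. The Durfee identity \<open>1 / (q)_\<infinity> = sum_m q^{m(m+n)} / ((q)_m (q)_{m+n})\<close> and the
  q-Vandermonde identity \<open>1 / ((q)_a (q)_b) = sum_i q^{(a-i)(b-i)} / ((q)_i (q)_{a-i} (q)_{b-i})\<close> may be
  inserted into any convergent series, since their terms are bounded by a fixed summable multiple of their
  values. Every identity thus starts from a theta series \<open>sum_n q^{n^2} z^n\<close>, which Jacobi's triple product
  evaluates.

  By q-Vandermonde, the triple sum with the additional weight \<open>u^{i+k} v^{i+j}\<close> equals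
  \<open>G(u, v) = sum_{a,b} q^{a^2-ab+b^2} u^a v^b / ((q)_a (q)_b)\<close>, and by Durfee
  \<open>G(1/z, z) = sum_n q^{n^2} z^n / (q)_\<infinity>\<close>; this is the first identity. The recurrence
  \<open>G(u, v) = G(uq, v) + uq G(uq^2, v/q)\<close> reduces the second and the fifth to it.

  For the third and fourth identity, Gauss's sums
  \<open>sum_r (-1)^r q^{r^2} / ((q)_{s-r} (q)_{s+r+e}) = 1 / (q^2; q^2)_s\<close>, \<open>e = 0, 1\<close>, start a Bailey chain that
  ends in Bressoud's double sums \<open>sum_{N,s} q^{N^2+eN+s^2+es} / ((q^2; q^2)_s (q; q)_{N-s})\<close>. Expanding
  \<open>1 / (q; q)_{N-s}\<close> over the base \<open>q^2\<close> gives a fourfold sum, one index of which is summed by q-Vandermonde.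
\<close>

subsection \<open>q-Pochhammer symbols\<close>

lemma norm_power_less_1:
  fixes q :: "'a :: real_normed_div_algebra"
  shows "norm q < 1 \<Longrightarrow> 0 < n \<Longrightarrow> norm (q ^ n) < 1"
  by (simp add: norm_power power_less_one_iff)

lemma power_neq_1:
  fixes q :: "'a :: real_normed_div_algebra"
  shows "norm q < 1 \<Longrightarrow> 0 < n \<Longrightarrow> q ^ n \<noteq> 1"
  using power_eq_1_iff[of q n] by auto

lemma qpoch_0 [simp]: "qpoch a q 0 = 1"
  by (simp add: qpoch_def)

lemma qpoch_Suc: "qpoch a q (Suc n) = qpoch a q n * (1 - a * q ^ n)"
  by (simp add: qpoch_def)

lemma qpoch_self_nonzero: "norm q < 1 \<Longrightarrow> qpoch q q n \<noteq> 0"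
  using power_neq_1[of q "Suc _"] by (auto simp: qpoch_def)

lemma convergent_prod_qpoch:
  fixes a q :: complex
  assumes "norm q < 1"
  shows "convergent_prod (\<lambda>k. 1 - a * q ^ k)"
proof -
  have "summable (\<lambda>k. norm (a * q ^ k))"
    unfolding norm_mult norm_power using assms by (intro summable_mult summable_geometric) auto
  hence "abs_convergent_prod (\<lambda>k. 1 + (- (a * q ^ k)))"
    by (intro summable_imp_abs_convergent_prod) simp
  thus ?thesis by (simp add: abs_convergent_prod_imp_convergent_prod)
qed

lemma qpoch_tendsto_qpoch_inf:
  assumes "norm q < 1"
  shows "qpoch a q \<longlonglongrightarrow> qpoch_inf a q"
proof -
  have "(\<lambda>n. qpoch a q (Suc n)) \<longlonglongrightarrow> qpoch_inf a q"
    using convergent_prod_LIMSEQ[OF convergent_prod_qpoch[OF assms]]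
    by (simp add: qpoch_def qpoch_inf_def lessThan_Suc_atMost)
  thus ?thesis by (rule LIMSEQ_imp_Suc)
qed

lemma qpoch_inf_self_nonzero: "norm q < 1 \<Longrightarrow> qpoch_inf q q \<noteq> 0"
  unfolding qpoch_inf_def
  using power_neq_1[of q "Suc _"] by (intro prodinf_nonzero convergent_prod_qpoch) auto

lemma qpoch_inf_rec:
  assumes "norm q < 1"
  shows "qpoch_inf a q = (1 - a) * qpoch_inf (a * q) q"
proof -
  have "qpoch a q (Suc n) = (1 - a) * qpoch (a * q) q n" for n
    by (induction n) (simp_all add: qpoch_Suc)
  hence "(\<lambda>n. qpoch a q (Suc n)) \<longlonglongrightarrow> (1 - a) * qpoch_inf (a * q) q"
    by (simp only:) (intro tendsto_mult tendsto_const qpoch_tendsto_qpoch_inf assms)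
  moreover have "(\<lambda>n. qpoch a q (Suc n)) \<longlonglongrightarrow> qpoch_inf a q"
    by (intro LIMSEQ_Suc qpoch_tendsto_qpoch_inf assms)
  ultimately show ?thesis using LIMSEQ_unique by blast
qed

lemma qpoch_inf_split_parity:
  assumes "norm q < 1"
  shows "qpoch_inf a q = qpoch_inf a (q^2) * qpoch_inf (a * q) (q^2)"
proof -
  have "qpoch a q (2 * n) = qpoch a (q^2) n * qpoch (a * q) (q^2) n" for n
    by (induction n) (simp_all add: qpoch_Suc power_mult[symmetric])
  hence "(\<lambda>n. qpoch a q (2 * n)) \<longlonglongrightarrow> qpoch_inf a (q^2) * qpoch_inf (a * q) (q^2)"
    by (simp only:) (intro tendsto_mult qpoch_tendsto_qpoch_inf norm_power_less_1 assms; simp)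
  moreover have "(\<lambda>n. qpoch a q (2 * n)) \<longlonglongrightarrow> qpoch_inf a q"
    using LIMSEQ_subseq_LIMSEQ[OF qpoch_tendsto_qpoch_inf[OF assms], of "\<lambda>n. 2 * n"]
    by (simp add: strict_mono_def o_def)
  ultimately show ?thesis using LIMSEQ_unique by blast
qed

lemma qpoch_inf_mult_uminus:
  assumes "norm q < 1"
  shows "qpoch_inf a q * qpoch_inf (- a) q = qpoch_inf (a^2) (q^2)"
proof -
  have "qpoch a q n * qpoch (- a) q n = qpoch (a^2) (q^2) n" for n
    by (induction n) (simp_all add: qpoch_Suc power_mult[symmetric] algebra_simps power2_eq_square
        power_add mult_2)
  hence "(\<lambda>n. qpoch a q n * qpoch (- a) q n) \<longlonglongrightarrow> qpoch_inf (a^2) (q^2)"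
    by (simp only:) (intro qpoch_tendsto_qpoch_inf norm_power_less_1 assms; simp)
  moreover have "(\<lambda>n. qpoch a q n * qpoch (- a) q n) \<longlonglongrightarrow> qpoch_inf a q * qpoch_inf (- a) q"
    by (intro tendsto_mult qpoch_tendsto_qpoch_inf assms)
  ultimately show ?thesis using LIMSEQ_unique by blast
qed

subsection \<open>Reciprocal q-factorials at integers\<close>

definition inv_qpoch :: "complex \<Rightarrow> int \<Rightarrow> complex" where
  "inv_qpoch q n = (if n < 0 then 0 else 1 / qpoch q q (nat n))"

lemma inv_qpoch_neg [simp]: "n < 0 \<Longrightarrow> inv_qpoch q n = 0"
  by (simp add: inv_qpoch_def)

lemma inv_qpoch_0 [simp]: "inv_qpoch q 0 = 1"
  by (simp add: inv_qpoch_def)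

lemma inv_qpoch_of_nat: "inv_qpoch q (int n) = 1 / qpoch q q n"
  by (simp add: inv_qpoch_def)

lemma one_minus_power_int_nonzero:
  fixes q :: "'a :: real_normed_field"
  assumes "norm q < 1" "0 < n"
  shows "1 - q powi n \<noteq> 0"
  using power_neq_1[of q "nat n"] assms by (simp add: power_int_nonneg_exp)

lemma inv_qpoch_rec:
  assumes "norm q < 1"
  shows "(1 - q powi n) * inv_qpoch q n = inv_qpoch q (n - 1)"
proof (cases "n > 0")
  case True
  define m where "m = nat (n - 1)"
  have n: "n = int (Suc m)" using True by (simp add: m_def)
  have "1 - q ^ Suc m \<noteq> 0"
    using one_minus_power_int_nonzero[OF assms True] unfolding n power_int_of_nat .
  moreover have "inv_qpoch q n = 1 / (qpoch q q m * (1 - q ^ Suc m))"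
    unfolding n inv_qpoch_of_nat qpoch_Suc by simp
  moreover have "inv_qpoch q (n - 1) = 1 / qpoch q q m" using n by (simp add: inv_qpoch_of_nat)
  ultimately show ?thesis unfolding n power_int_of_nat by simp
next
  case False
  thus ?thesis by (cases "n = 0") auto
qed

lemma inv_qpoch_unique:
  fixes f :: "int \<Rightarrow> complex"
  assumes q: "norm q < 1"
    and neg: "\<And>n. n < 0 \<Longrightarrow> f n = 0"
    and rec: "\<And>n. (1 - q powi n) * f n = f (n - 1)"
  shows "f n = f 0 * inv_qpoch q n"
proof (cases "n < 0")
  case False
  hence "n \<ge> 0" by simp
  thus ?thesis
  proof (induction n rule: int_ge_induct)
    case (step n)
    have "(1 - q powi (n + 1)) * f (n + 1) = (1 - q powi (n + 1)) * (f 0 * inv_qpoch q (n + 1))"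
      using rec[of "n + 1"] inv_qpoch_rec[OF q, of "n + 1"] step by (simp add: mult_ac)
    thus ?case using one_minus_power_int_nonzero[OF q, of "n + 1"] step by simp
  qed simp
qed (simp add: neg)

lemma inv_qpoch_tendsto:
  assumes "norm q < 1"
  shows "(\<lambda>n. inv_qpoch q (int n + k)) \<longlonglongrightarrow> 1 / qpoch_inf q q"
proof -
  have "(\<lambda>n. inv_qpoch q (int n)) \<longlonglongrightarrow> 1 / qpoch_inf q q"
    unfolding inv_qpoch_of_nat
    by (intro tendsto_divide tendsto_const qpoch_tendsto_qpoch_inf qpoch_inf_self_nonzero assms)
  hence "(\<lambda>n. inv_qpoch q (int (n - nat (- k) + nat k))) \<longlonglongrightarrow> 1 / qpoch_inf q q"
    by (rule filterlim_compose)
       (auto intro: filterlim_compose[OF filterlim_add_const_nat_at_top filterlim_minus_const_nat_at_top])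
  moreover have "\<forall>\<^sub>F n in sequentially.
      inv_qpoch q (int (n - nat (- k) + nat k)) = inv_qpoch q (int n + k)"
    using eventually_ge_at_top[of "nat (- k)"]
    by eventually_elim (rule arg_cong[of _ _ "inv_qpoch q"], linarith)
  ultimately show ?thesis by (rule Lim_transform_eventually)
qed

lemma inv_qpoch_bounds:
  assumes "norm q < 1"
  obtains K where "K > 0" "\<And>n. norm (inv_qpoch q n) \<le> K" "\<And>n. n \<ge> 0 \<Longrightarrow> 1 \<le> K * norm (inv_qpoch q n)"
proof -
  have lim: "qpoch q q \<longlonglongrightarrow> qpoch_inf q q" by (rule qpoch_tendsto_qpoch_inf[OF assms])
  have "(\<lambda>n. 1 / qpoch q q n) \<longlonglongrightarrow> 1 / qpoch_inf q q"
    by (intro tendsto_divide tendsto_const lim qpoch_inf_self_nonzero assms)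
  then obtain A where A: "A > 0" "\<And>n. norm (1 / qpoch q q n) \<le> A"
    using Bseq_def convergent_imp_Bseq convergentI by metis
  obtain B where B: "B > 0" "\<And>n. norm (qpoch q q n) \<le> B"
    using lim Bseq_def convergent_imp_Bseq convergentI by metis
  show ?thesis
  proof (rule that[of "max A B"])
    show "max A B > 0" using A by simp
    show "norm (inv_qpoch q n) \<le> max A B" for n
      using A(1) A(2)[of "nat n"] by (simp add: inv_qpoch_def le_max_iff_disj)
    show "1 \<le> max A B * norm (inv_qpoch q n)" if "n \<ge> 0" for n
      using that B(2)[of "nat n"] qpoch_self_nonzero[OF assms, of "nat n"]
      by (simp add: inv_qpoch_def norm_divide field_simps)
  qed
qed

subsection \<open>Infinite sums\<close>

lemma has_sum_reindex_UNIV: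
  assumes "(f has_sum S) UNIV" "\<And>x. i (j x) = x" "\<And>x. j (i x) = x" "\<And>x. g x = f (j x)"
  shows "(g has_sum S) UNIV"
  using assms(1) by (subst has_sum_reindex_bij_witness[of UNIV i j UNIV f g S S]) (use assms in auto)

lemma has_sum_collapse:
  fixes f :: "'a \<times> 'b \<Rightarrow> 'c :: {topological_comm_monoid_add, t3_space}"
  assumes "(f has_sum S) UNIV" "\<And>x. ((\<lambda>y. f (x, y)) has_sum g x) UNIV"
  shows "(g has_sum S) UNIV"
  by (rule has_sum_SigmaD[where f = f and B = "\<lambda>_. UNIV"]) (use assms in simp_all)

lemma summable_on_product_nonneg:
  fixes f :: "'a \<Rightarrow> real" and g :: "'b \<Rightarrow> real"
  assumes "f summable_on UNIV" "g summable_on UNIV" "\<And>x. f x \<ge> 0" "\<And>x. g x \<ge> 0"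
  shows "(\<lambda>(x, y). f x * g y) summable_on UNIV"
proof -
  have "(\<lambda>(x, y). f x * g y) summable_on Sigma UNIV (\<lambda>_. UNIV)"
    by (rule summable_on_SigmaI[where g = "\<lambda>x. f x * infsum g UNIV"])
       (use assms in \<open>auto intro!: has_sum_cmult_right summable_on_cmult_left\<close>)
  thus ?thesis by simp
qed

text \<open>A collapse read backwards: the inner sums may be expanded as soon as they converge absolutely,
  uniformly in proportion to their values.\<close>
lemma has_sum_expand:
  fixes f :: "'a \<Rightarrow> 'b \<Rightarrow> complex" and h :: "'c \<Rightarrow> real"
  assumes S: "((\<lambda>x. c x * g x) has_sum S) UNIV"
    and f: "\<And>x. (f x has_sum g x) UNIV"
    and h: "h summable_on UNIV" "\<And>z. 0 \<le> h z"
    and \<phi>: "\<And>x. inj (\<phi> x)"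
    and bound: "\<And>x y. norm (f x y) \<le> C * norm (g x) * h (\<phi> x y)"
  shows "((\<lambda>(x, y). c x * f x y) has_sum S) UNIV"
proof -
  define b where "b = (\<lambda>(x, z). norm (c x * g x) * h z)"
  define \<psi> where "\<psi> = (\<lambda>(x, y). (x, \<phi> x y))"
  have "inj \<psi>" using \<phi> by (auto simp: \<psi>_def inj_def)
  have "(\<lambda>x. norm (c x * g x)) summable_on UNIV"
    using has_sum_imp_summable[OF S] by (simp only: summable_on_iff_abs_summable_on_complex)
  hence "b summable_on UNIV"
    unfolding b_def by (intro summable_on_product_nonneg h) auto
  hence "b summable_on range \<psi>" by (rule summable_on_subset) simp
  hence "(\<lambda>p. C * b (\<psi> p)) summable_on UNIV"
    using \<open>inj \<psi>\<close> by (intro summable_on_cmult_right) (simp add: summable_on_reindex o_def)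
  hence "(\<lambda>p. norm (case p of (x, y) \<Rightarrow> c x * f x y)) summable_on UNIV"
  proof (rule Infinite_Sum.abs_summable_on_comparison_test')
    fix p :: "'a \<times> 'b"
    obtain x y where "p = (x, y)" by (cases p)
    thus "norm (case p of (x, y) \<Rightarrow> c x * f x y) \<le> C * b (\<psi> p)"
      using mult_left_mono[OF bound[of x y], of "norm (c x)"] by (simp add: b_def \<psi>_def norm_mult mult_ac)
  qed
  then obtain T where T: "((\<lambda>(x, y). c x * f x y) has_sum T) UNIV"
    using abs_summable_summable summable_on_def by blast
  hence "((\<lambda>x. c x * g x) has_sum T) UNIV"
    by (rule has_sum_collapse) (auto intro: has_sum_cmult_right f)
  with S T show ?thesis using has_sum_unique by blast
qed

lemma has_sum_dominated_limit:
  fixes f :: "nat \<Rightarrow> 'a \<Rightarrow> 'b :: banach"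
  assumes S: "\<And>n. (f n has_sum S n) UNIV" "S \<longlonglongrightarrow> T"
    and lim: "\<And>x. (\<lambda>n. f n x) \<longlonglongrightarrow> g x"
    and h: "h summable_on UNIV" "\<And>n x. norm (f n x) \<le> h x"
  shows "(g has_sum T) UNIV"
proof -
  have "norm (g x) \<le> h x" for x
    using h(2) by (intro LIMSEQ_le_const2[OF tendsto_norm[OF lim]]) auto
  hence "(\<lambda>x. norm (g x)) summable_on UNIV"
    by (intro Infinite_Sum.abs_summable_on_comparison_test'[OF h(1)]) auto
  then obtain G where G: "(g has_sum G) UNIV"
    using abs_summable_summable summable_on_def by blast
  have "S \<longlonglongrightarrow> G"
  proof (rule swap_uniform_limit')
    show "uniform_limit UNIV (\<lambda>F n. sum (f n) F) S (finite_subsets_at_top UNIV)"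
      using h S by (intro Weierstrass_m_test_general'[where f = "\<lambda>x n. f n x" and M = h]) auto
    show "\<forall>\<^sub>F F in finite_subsets_at_top UNIV. (\<lambda>n. sum (f n) F) \<longlonglongrightarrow> sum g F"
      by (intro always_eventually allI tendsto_sum lim)
    show "(sum g \<longlongrightarrow> G) (finite_subsets_at_top UNIV)"
      using G by (simp add: has_sum_def)
  qed auto
  thus ?thesis using G S(2) LIMSEQ_unique by blast
qed

subsection \<open>Theta series\<close>

lemma power_int_mult_eqI:
  fixes x :: "'a :: field"
  shows "x \<noteq> 0 \<Longrightarrow> m + n = k \<Longrightarrow> x powi m * x powi n = x powi k"
  by (simp add: power_int_add[symmetric])

definition theta_term :: "'a :: field \<Rightarrow> 'a \<Rightarrow> int \<Rightarrow> 'a" where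
  "theta_term q z n = q powi (n^2) * z powi n"

lemma norm_theta_term:
  fixes q z :: "'a :: real_normed_field"
  shows "norm (theta_term q z n) = theta_term (norm q) (norm z) n"
  by (simp add: theta_term_def norm_mult norm_power_int)

lemma theta_term_nonneg:
  fixes r c :: real
  shows "0 \<le> r \<Longrightarrow> 0 \<le> c \<Longrightarrow> 0 \<le> theta_term r c n"
  by (simp add: theta_term_def)

lemma theta_term_minus: "theta_term q z (- n) = theta_term q (inverse z) n"
  by (simp add: theta_term_def power_int_minus power_int_inverse)

lemma theta_term_add_1:
  assumes "q \<noteq> 0" "z \<noteq> 0"
  shows "theta_term q z (n + 1) = q * z * theta_term q (q^2 * z) n"
proof -
  have "(n + 1)^2 = n^2 + 2 * n + 1" by (simp add: power2_eq_square algebra_simps)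
  hence "q powi ((n + 1)^2) = q powi (n^2) * q powi (2 * n) * q"
    using assms by (simp add: power_int_add)
  moreover have "q powi (2 * n) = (q^2) powi n" by (simp add: power_int_mult)
  ultimately show ?thesis
    using assms by (simp add: theta_term_def power_int_add power_int_mult_distrib)
qed

lemma summable_theta_nat:
  fixes r c :: real
  assumes "0 < r" "r < 1" "0 < c"
  shows "summable (\<lambda>n. theta_term r c (int n))"
proof -
  have "(\<lambda>n. (r^2) ^ n * (r * c)) \<longlonglongrightarrow> 0 * (r * c)"
    using assms
    by (intro tendsto_mult LIMSEQ_power_zero tendsto_const) (auto simp: power_less_one_iff)
  hence "\<forall>\<^sub>F n in sequentially. (r^2) ^ n * (r * c) < 1/2"
    by (intro order_tendstoD(2)[of _ 0]) auto
  then obtain N where N: "\<And>n. n \<ge> N \<Longrightarrow> (r^2) ^ n * (r * c) < 1/2"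
    by (auto simp: eventually_sequentially)
  show ?thesis
  proof (rule summable_ratio_test[of "1/2" N])
    fix n assume "n \<ge> N"
    have "theta_term r c (int (Suc n)) = theta_term r c (int n + 1)" by (simp add: add.commute)
    also have "\<dots> = r * c * theta_term r (r^2 * c) (int n)"
      using assms by (intro theta_term_add_1) auto
    also have "\<dots> = (r^2) ^ n * (r * c) * theta_term r c (int n)"
      by (simp add: theta_term_def power_mult_distrib)
    also have "\<dots> \<le> 1/2 * theta_term r c (int n)"
      using N[OF \<open>n \<ge> N\<close>] assms by (intro mult_right_mono theta_term_nonneg) auto
    finally show "norm (theta_term r c (int (Suc n))) \<le> 1/2 * norm (theta_term r c (int n))"
      using assms by (simp add: theta_term_nonneg del: of_nat_Suc)
  qed simp
qed

lemma summable_on_theta_term_real: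
  fixes r c :: real
  assumes "0 < r" "r < 1" "0 < c"
  shows "theta_term r c summable_on UNIV"
proof -
  have half: "theta_term r d summable_on range int" if "0 < d" for d
    using summable_theta_nat[OF assms(1,2) that] assms that
    by (subst summable_on_reindex)
       (auto simp: o_def theta_term_nonneg intro!: summable_nonneg_imp_summable_on)
  have "theta_term r c summable_on uminus ` range int"
    using half[of "inverse c"] assms
    by (subst summable_on_reindex) (auto simp: o_def theta_term_minus inj_on_def)
  hence "theta_term r c summable_on range int \<union> uminus ` range int"
    by (intro summable_on_union half assms)
  also have "range int \<union> uminus ` range int = UNIV"
    by (auto simp: image_iff) (metis int_cases2)
  finally show ?thesis .
qed

lemma summable_on_theta_term:
  fixes q z :: "'a :: {real_normed_field, banach}"
  assumes "norm q < 1" "q \<noteq> 0" "z \<noteq> 0"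
  shows "theta_term q z summable_on UNIV"
proof (rule abs_summable_summable)
  show "(\<lambda>n. norm (theta_term q z n)) summable_on UNIV"
    unfolding norm_theta_term using assms by (intro summable_on_theta_term_real) auto
qed

lemma summable_on_theta_product:
  fixes r c d :: real
  assumes "0 < r" "r < 1" "0 < c" "0 < d"
  shows "(\<lambda>(m, n). theta_term r c m * theta_term r d n) summable_on UNIV"
  using assms by (intro summable_on_product_nonneg summable_on_theta_term_real theta_term_nonneg) auto

definition jacobi_theta :: "complex \<Rightarrow> complex \<Rightarrow> complex" where
  "jacobi_theta q z = (\<Sum>\<^sub>\<infinity>n. theta_term q z n)"

lemma has_sum_jacobi_theta:
  assumes "norm q < 1" "q \<noteq> 0" "z \<noteq> 0"
  shows "(theta_term q z has_sum jacobi_theta q z) UNIV"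
  unfolding jacobi_theta_def by (intro has_sum_infsum summable_on_theta_term assms)

lemma jacobi_theta_inverse: "jacobi_theta q (1 / z) = jacobi_theta q z"
  unfolding jacobi_theta_def
  by (rule infsum_reindex_bij_witness[where i = uminus and j = uminus])
     (auto simp: theta_term_minus inverse_eq_divide)

lemma jacobi_theta_quasiperiodic:
  assumes "q \<noteq> 0" "z \<noteq> 0"
  shows "jacobi_theta q z = q * z * jacobi_theta q (q^2 * z)"
proof -
  have "jacobi_theta q z = (\<Sum>\<^sub>\<infinity>n. theta_term q z (n + 1))"
    unfolding jacobi_theta_def
    by (rule infsum_reindex_bij_witness[where i = "\<lambda>n. n + 1" and j = "\<lambda>n. n - 1"]) auto
  thus ?thesis by (simp add: theta_term_add_1[OF assms] infsum_cmult_right' jacobi_theta_def)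
qed

subsection \<open>The q-Vandermonde and Durfee identities\<close>

definition durfee_term :: "complex \<Rightarrow> int \<Rightarrow> int \<Rightarrow> complex" where
  "durfee_term q m n = q powi (m * n) * (inv_qpoch q m * inv_qpoch q n)"

lemma durfee_term_commute: "durfee_term q m n = durfee_term q n m"
  by (simp add: durfee_term_def mult_ac)

lemma durfee_term_eq_0: "m < 0 \<or> n < 0 \<Longrightarrow> durfee_term q m n = 0"
  by (auto simp: durfee_term_def)

lemma durfee_term_rec:
  assumes "norm q < 1" "q \<noteq> 0"
  shows "(1 - q powi m) * durfee_term q m n = q powi n * durfee_term q (m - 1) n"
proof -
  have "q powi (m * n) = q powi n * q powi ((m - 1) * n)"
    using assms by (intro power_int_mult_eqI[symmetric]) (auto simp: algebra_simps)
  thus ?thesis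
    using inv_qpoch_rec[OF assms(1), of m, symmetric] by (simp add: durfee_term_def mult_ac)
qed

lemma norm_durfee_term_le:
  assumes q: "norm q < 1" "q \<noteq> 0" and K: "\<And>n. norm (inv_qpoch q n) \<le> K"
  shows "norm (durfee_term q m n) \<le> K^2 * theta_term (norm q) 1 (min m n)"
proof (cases "m < 0 \<or> n < 0")
  case True
  thus ?thesis by (simp add: durfee_term_eq_0 theta_term_nonneg)
next
  case False
  hence "(min m n)^2 \<le> m * n" unfolding power2_eq_square by (intro mult_mono) auto
  hence "norm q powi (m * n) \<le> norm q powi ((min m n)^2)"
    using q by (intro power_int_decreasing) auto
  moreover have "norm (inv_qpoch q m) * norm (inv_qpoch q n) \<le> K * K"
    using order_trans[OF norm_ge_zero K] by (intro mult_mono K) auto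
  ultimately have "norm (durfee_term q m n) \<le> norm q powi ((min m n)^2) * (K * K)"
    unfolding durfee_term_def norm_mult norm_power_int by (rule mult_mono) auto
  thus ?thesis by (simp add: theta_term_def power2_eq_square mult_ac)
qed

definition vandermonde_term :: "complex \<Rightarrow> int \<Rightarrow> int \<Rightarrow> int \<Rightarrow> complex" where
  "vandermonde_term q a b i = inv_qpoch q i * durfee_term q (a - i) (b - i)"

lemma vandermonde_term_eq_0: "i < 0 \<or> a < i \<or> b < i \<Longrightarrow> vandermonde_term q a b i = 0"
  by (auto simp: vandermonde_term_def durfee_term_eq_0)

lemma vandermonde_term_rec:
  assumes q: "norm q < 1" "q \<noteq> 0"
  shows "(1 - q powi a) * vandermonde_term q a b i = q powi (b - i) * vandermonde_term q (a - 1) b i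
           + (1 - q powi (b - (i - 1))) * vandermonde_term q (a - 1) b (i - 1)"
proof -
  have split: "1 - q powi a = (1 - q powi (a - i)) + q powi (a - i) * (1 - q powi i)"
    using q power_int_add[of q "a - i" i] by (simp add: right_diff_distrib)
  have "(1 - q powi a) * vandermonde_term q a b i =
      inv_qpoch q i * ((1 - q powi (a - i)) * durfee_term q (a - i) (b - i))
      + (1 - q powi i) * inv_qpoch q i * (q powi (a - i) * durfee_term q (b - i) (a - i))"
    unfolding split vandermonde_term_def durfee_term_commute[of q "b - i"]
    by (simp only: distrib_left distrib_right mult_ac)
  also have "(1 - q powi (a - i)) * durfee_term q (a - i) (b - i) =
      q powi (b - i) * durfee_term q (a - 1 - i) (b - i)"
    by (subst durfee_term_rec[OF q]) (simp add: algebra_simps)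
  also have "(1 - q powi i) * inv_qpoch q i = inv_qpoch q (i - 1)"
    by (rule inv_qpoch_rec[OF q(1)])
  also have "q powi (a - i) * durfee_term q (b - i) (a - i) =
      (1 - q powi (b - (i - 1))) * durfee_term q (b - (i - 1)) (a - i)"
    by (subst durfee_term_rec[OF q]) simp
  finally show ?thesis
    by (simp add: vandermonde_term_def durfee_term_commute[of q "a - i"] mult_ac)
qed

lemma summable_vandermonde_term: "(\<lambda>i. g i * vandermonde_term q a b i) summable_on UNIV"
proof (rule finite_nonzero_values_imp_summable_on, rule finite_subset)
  show "{i \<in> UNIV. g i * vandermonde_term q a b i \<noteq> 0} \<subseteq> {0..a}"
    using vandermonde_term_eq_0[of _ a b q] by force
qed simp

lemma infsum_vandermonde_term_rec:
  assumes q: "norm q < 1" "q \<noteq> 0"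
  shows "(1 - q powi a) * infsum (vandermonde_term q a b) UNIV =
      infsum (vandermonde_term q (a - 1) b) UNIV"
proof -
  define u where "u i = q powi (b - i) * vandermonde_term q (a - 1) b i" for i
  define v where "v i = (1 - q powi (b - i)) * vandermonde_term q (a - 1) b i" for i
  have u: "u summable_on UNIV" unfolding u_def by (rule summable_vandermonde_term)
  have v: "v summable_on UNIV" unfolding v_def by (rule summable_vandermonde_term)
  have v_shift: "((\<lambda>i. v (i - 1)) has_sum infsum v UNIV) UNIV"
    by (rule has_sum_reindex_UNIV[OF has_sum_infsum[OF v],
          where i = "\<lambda>i. i + 1" and j = "\<lambda>i. i - 1"]) auto
  have "(1 - q powi a) * infsum (vandermonde_term q a b) UNIV = (\<Sum>\<^sub>\<infinity>i. u i + v (i - 1))"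
    by (simp only: infsum_cmult_right'[symmetric] vandermonde_term_rec[OF q] u_def v_def)
  also have "\<dots> = infsum u UNIV + infsum v UNIV"
    using has_sum_add[OF has_sum_infsum[OF u] v_shift] by (rule infsumI)
  also have "\<dots> = infsum (vandermonde_term q (a - 1) b) UNIV"
    unfolding infsum_add[OF u v, symmetric] by (simp add: u_def v_def left_diff_distrib)
  finally show ?thesis .
qed

theorem has_sum_q_vandermonde:
  assumes q: "norm q < 1" "q \<noteq> 0"
  shows "(vandermonde_term q a b has_sum inv_qpoch q a * inv_qpoch q b) UNIV"
proof -
  define V where "V a = infsum (vandermonde_term q a b) UNIV" for a
  have "V a = 0" if "a < 0" for a
    unfolding V_def by (rule infsum_0, rule vandermonde_term_eq_0) (use that in auto)
  hence "V a = V 0 * inv_qpoch q a"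
    using infsum_vandermonde_term_rec[OF q] by (intro inv_qpoch_unique q) (simp_all add: V_def)
  moreover have "(vandermonde_term q 0 b has_sum inv_qpoch q b) UNIV"
  proof (rule has_sum_finite_neutralI[of "{0}"])
    show "vandermonde_term q 0 b i = 0" if "i \<in> UNIV - {0}" for i
      using that by (intro vandermonde_term_eq_0) auto
  qed (simp_all add: vandermonde_term_def durfee_term_def)
  hence "V 0 = inv_qpoch q b" unfolding V_def by (rule infsumI)
  moreover have "(vandermonde_term q a b has_sum V a) UNIV"
    using summable_vandermonde_term[of "\<lambda>_. 1"] by (simp add: V_def)
  ultimately show ?thesis by (simp add: mult.commute)
qed

text \<open>The limit \<open>a, b \<rightarrow> \<infinity>\<close> with \<open>b - a = n\<close> of the q-Vandermonde identity.\<close>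
lemma has_sum_durfee:
  assumes q: "norm q < 1" "q \<noteq> 0"
  shows "((\<lambda>m. durfee_term q m (m + n)) has_sum 1 / qpoch_inf q q) UNIV"
proof -
  obtain K where K: "K > 0" "\<And>n. norm (inv_qpoch q n) \<le> K" using inv_qpoch_bounds[OF q(1)] by metis
  define P where "P = qpoch_inf q q"
  have "((\<lambda>m. 1 / P * durfee_term q m (m + n)) has_sum 1 / P * (1 / P)) UNIV"
  proof (rule has_sum_dominated_limit)
    show "((\<lambda>m. inv_qpoch q (int N - m) * durfee_term q m (m + n)) has_sum
            inv_qpoch q (int N) * inv_qpoch q (int N + n)) UNIV" for N
      by (rule has_sum_reindex_UNIV[OF has_sum_q_vandermonde[OF q],
            where i = "\<lambda>i. int N - i" and j = "\<lambda>m. int N - m"])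
         (auto simp: vandermonde_term_def algebra_simps)
    show "(\<lambda>N. inv_qpoch q (int N) * inv_qpoch q (int N + n)) \<longlonglongrightarrow> 1 / P * (1 / P)"
      unfolding P_def using inv_qpoch_tendsto[OF q(1), of 0]
      by (intro tendsto_mult inv_qpoch_tendsto q) simp
    show "(\<lambda>N. inv_qpoch q (int N - m) * durfee_term q m (m + n)) \<longlonglongrightarrow> 1 / P * durfee_term q m (m + n)"
      for m
      unfolding P_def using inv_qpoch_tendsto[OF q(1), of "- m"] by (intro tendsto_mult) auto
    have "(\<lambda>m. theta_term (norm q) 1 (m + min 0 n)) summable_on UNIV"
      using summable_on_theta_term_real[of "norm q" 1] q
      by (subst summable_on_reindex_bij_witness[of UNIV "\<lambda>m. m - min 0 n"
            "\<lambda>m. m + min 0 n" UNIV]) auto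
    thus "(\<lambda>m. K * (K^2 * theta_term (norm q) 1 (m + min 0 n))) summable_on UNIV"
      by (intro summable_on_cmult_right)
    fix N m
    have "min m (m + n) = m + min 0 n" by auto
    thus "norm (inv_qpoch q (int N - m) * durfee_term q m (m + n)) \<le>
        K * (K^2 * theta_term (norm q) 1 (m + min 0 n))"
      unfolding norm_mult using norm_durfee_term_le[OF q K(2), of m "m + n"] K
      by (intro mult_mono) auto
  qed
  hence "((\<lambda>m. P * (1 / P * durfee_term q m (m + n))) has_sum P * (1 / P * (1 / P))) UNIV"
    by (rule has_sum_cmult_right)
  thus ?thesis using qpoch_inf_self_nonzero[OF q(1)] by (simp add: P_def)
qed

lemma has_sum_durfee_expand:
  assumes q: "norm q < 1" "q \<noteq> 0" and c: "(c has_sum S) UNIV"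
  shows "((\<lambda>(x, m). c x * durfee_term q m (m + n x)) has_sum S / qpoch_inf q q) UNIV"
proof -
  obtain K where K: "K > 0" "\<And>n. norm (inv_qpoch q n) \<le> K" using inv_qpoch_bounds[OF q(1)] by metis
  show ?thesis
  proof (rule has_sum_expand[where \<phi> = "\<lambda>x m. m + min 0 (n x)" and h = "theta_term (norm q) 1"
                               and C = "K^2 * norm (qpoch_inf q q)"])
    show "((\<lambda>x. c x * (1 / qpoch_inf q q)) has_sum S / qpoch_inf q q) UNIV"
      using has_sum_cmult_left[OF c, of "1 / qpoch_inf q q"] by simp
    show "norm (durfee_term q m (m + n x)) \<le>
        K^2 * norm (qpoch_inf q q) * norm (1 / qpoch_inf q q) * theta_term (norm q) 1 (m + min 0 (n x))"
      for x m
    proof -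
      have "min m (m + n x) = m + min 0 (n x)" by auto
      thus ?thesis
        using norm_durfee_term_le[OF q K(2), of m "m + n x"] qpoch_inf_self_nonzero[OF q(1)]
        by (simp add: norm_divide)
    qed
  qed (use q in \<open>auto intro: has_sum_durfee summable_on_theta_term_real theta_term_nonneg
      simp: inj_def\<close>)
qed

lemma norm_vandermonde_term_le:
  assumes q: "norm q < 1" "q \<noteq> 0"
    and K: "K > 0" "\<And>n. norm (inv_qpoch q n) \<le> K" "\<And>n. n \<ge> 0 \<Longrightarrow> 1 \<le> K * norm (inv_qpoch q n)"
  shows "norm (vandermonde_term q a b i) \<le>
           K^5 * norm (inv_qpoch q a * inv_qpoch q b) * theta_term (norm q) 1 (min a b - i)"
proof (cases "i < 0 \<or> a < i \<or> b < i")
  case True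
  thus ?thesis using K(1) by (simp add: vandermonde_term_eq_0 theta_term_nonneg)
next
  case False
  define t where "t = K * (K^2 * theta_term (norm q) 1 (min a b - i))"
  have "min (a - i) (b - i) = min a b - i" by auto
  hence "norm (vandermonde_term q a b i) \<le> t"
    unfolding vandermonde_term_def norm_mult t_def
    using norm_durfee_term_le[OF q K(2), of "a - i" "b - i"] K by (intro mult_mono) auto
  also have "1 * 1 \<le> (K * norm (inv_qpoch q a)) * (K * norm (inv_qpoch q b))"
    using False K by (intro mult_mono) auto
  hence "1 * 1 * t \<le> (K * norm (inv_qpoch q a)) * (K * norm (inv_qpoch q b)) * t"
    by (rule mult_right_mono) (use K in \<open>simp add: t_def theta_term_nonneg\<close>)
  finally show ?thesis by (simp add: t_def norm_mult eval_nat_numeral mult_ac)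
qed

lemma has_sum_vandermonde_expand:
  assumes q: "norm q < 1" "q \<noteq> 0"
    and S: "((\<lambda>x. c x * (inv_qpoch q (a x) * inv_qpoch q (b x))) has_sum S) UNIV"
  shows "((\<lambda>(x, i). c x * vandermonde_term q (a x) (b x) i) has_sum S) UNIV"
proof -
  obtain K where K: "K > 0" "\<And>n. norm (inv_qpoch q n) \<le> K"
    "\<And>n. n \<ge> 0 \<Longrightarrow> 1 \<le> K * norm (inv_qpoch q n)"
    using inv_qpoch_bounds[OF q(1)] by metis
  show ?thesis
  proof (rule has_sum_expand[OF S, where \<phi> = "\<lambda>x i. min (a x) (b x) - i"
        and h = "theta_term (norm q) 1" and C = "K^5"])
    show "norm (vandermonde_term q (a x) (b x) i) \<le>
        K^5 * norm (inv_qpoch q (a x) * inv_qpoch q (b x)) * theta_term (norm q) 1 (min (a x) (b x) - i)"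
      for x i
      by (rule norm_vandermonde_term_le[OF q K])
    show "theta_term (norm q) 1 summable_on UNIV"
      using q by (intro summable_on_theta_term_real) auto
  qed (auto intro: has_sum_q_vandermonde[OF q] theta_term_nonneg simp: inj_def)
qed

subsection \<open>Truncated theta series\<close>

definition truncated_theta_term :: "complex \<Rightarrow> complex \<Rightarrow> complex \<Rightarrow> int \<Rightarrow> int \<Rightarrow> int \<Rightarrow> complex" where
  "truncated_theta_term q p z s t r =
      theta_term p z r * (inv_qpoch q (s - r) * inv_qpoch q (t + r))"

definition truncated_theta :: "complex \<Rightarrow> complex \<Rightarrow> complex \<Rightarrow> int \<Rightarrow> int \<Rightarrow> complex" where
  "truncated_theta q p z s t = (\<Sum>\<^sub>\<infinity>r. truncated_theta_term q p z s t r)"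

lemma has_sum_truncated_theta:
  "(truncated_theta_term q p z s t has_sum truncated_theta q p z s t) UNIV"
  unfolding truncated_theta_def
proof (intro has_sum_infsum finite_nonzero_values_imp_summable_on, rule finite_subset)
  show "{r \<in> UNIV. truncated_theta_term q p z s t r \<noteq> 0} \<subseteq> {- t..s}"
    by (auto simp: truncated_theta_term_def inv_qpoch_def split: if_splits)
qed simp

lemma truncated_theta_eq_0:
  assumes "s + t < 0"
  shows "truncated_theta q p z s t = 0"
  unfolding truncated_theta_def
proof (rule infsum_0)
  fix r
  have "s - r < 0 \<or> t + r < 0" using assms by linarith
  thus "truncated_theta_term q p z s t r = 0" by (auto simp: truncated_theta_term_def)
qed

lemma truncated_theta_0_0: "truncated_theta q p z 0 0 = 1"
proof -
  have "(truncated_theta_term q p z 0 0 has_sum 1) UNIV"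
  proof (rule has_sum_finite_neutralI[of "{0}"])
    show "truncated_theta_term q p z 0 0 r = 0" if "r \<in> UNIV - {0}" for r
      using that by (cases "r < 0") (auto simp: truncated_theta_term_def)
  qed (auto simp: truncated_theta_term_def theta_term_def)
  thus ?thesis unfolding truncated_theta_def by (rule infsumI)
qed

lemma truncated_theta_reflect: "truncated_theta q p z s t = truncated_theta q p (1 / z) t s"
  unfolding truncated_theta_def
  by (rule infsum_reindex_bij_witness[where i = uminus and j = uminus])
     (auto simp: truncated_theta_term_def theta_term_minus inverse_eq_divide mult_ac)

lemma truncated_theta_shift:
  assumes "p \<noteq> 0" "z \<noteq> 0"
  shows "truncated_theta q p z s t = p * z * truncated_theta q p (p^2 * z) (s - 1) (t + 1)"
proof -
  have "truncated_theta q p z s t = (\<Sum>\<^sub>\<infinity>r. truncated_theta_term q p z s t (r + 1))"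
    unfolding truncated_theta_def
    by (rule infsum_reindex_bij_witness[where i = "\<lambda>r. r + 1" and j = "\<lambda>r. r - 1"]) auto
  also have "\<dots> = (\<Sum>\<^sub>\<infinity>r. p * z * truncated_theta_term q p (p^2 * z) (s - 1) (t + 1) r)"
  proof (rule infsum_cong)
    fix r
    have "s - (r + 1) = s - 1 - r" "t + (r + 1) = t + 1 + r" by simp_all
    thus "truncated_theta_term q p z s t (r + 1) =
        p * z * truncated_theta_term q p (p^2 * z) (s - 1) (t + 1) r"
      by (simp only: truncated_theta_term_def theta_term_add_1[OF assms] mult_ac)
  qed
  finally show ?thesis by (simp add: infsum_cmult_right' truncated_theta_def)
qed

lemma truncated_theta_rec_left:
  assumes q: "norm q < 1" "q \<noteq> 0"
  shows "truncated_theta q p z s t =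
           truncated_theta q p z (s - 1) t + q powi s * truncated_theta q p (z / q) s t"
proof -
  have term_rec: "truncated_theta_term q p z s t r =
      truncated_theta_term q p z (s - 1) t r + q powi s * truncated_theta_term q p (z / q) s t r"
    for r
  proof -
    have "theta_term p z r * q powi (s - r) = q powi s * theta_term p (z / q) r"
      using q by (simp add: theta_term_def power_int_diff power_int_divide_distrib)
    moreover have "inv_qpoch q (s - r) =
        inv_qpoch q (s - 1 - r) + q powi (s - r) * inv_qpoch q (s - r)"
      using inv_qpoch_rec[OF q(1), of "s - r"] by (simp add: algebra_simps)
    hence "theta_term p z r * inv_qpoch q (s - r) =
        theta_term p z r * inv_qpoch q (s - 1 - r)
        + theta_term p z r * q powi (s - r) * inv_qpoch q (s - r)"
      by (metis distrib_left mult.assoc)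
    ultimately show ?thesis
      by (simp add: truncated_theta_term_def distrib_right flip: mult.assoc)
  qed
  have "((\<lambda>r. truncated_theta_term q p z (s - 1) t r
        + q powi s * truncated_theta_term q p (z / q) s t r)
      has_sum truncated_theta q p z (s - 1) t + q powi s * truncated_theta q p (z / q) s t) UNIV"
    by (intro has_sum_add has_sum_cmult_right has_sum_truncated_theta)
  hence "(truncated_theta_term q p z s t has_sum
      truncated_theta q p z (s - 1) t + q powi s * truncated_theta q p (z / q) s t) UNIV"
    by (simp only: term_rec[symmetric])
  with has_sum_truncated_theta show ?thesis by (rule has_sum_unique)
qed

lemma truncated_theta_rec_right:
  assumes q: "norm q < 1" "q \<noteq> 0"
  shows "truncated_theta q p z s t =
           truncated_theta q p z s (t - 1) + q powi t * truncated_theta q p (z * q) s t"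
  using truncated_theta_rec_left[OF q, of p "1 / z" t s]
  by (simp add: truncated_theta_reflect[of q p "1 / z"]
        truncated_theta_reflect[of q p "1 / (z * q)"])

lemma jacobi_theta_eq_truncated_limit:
  assumes q: "norm q < 1" and p: "norm p < 1" "p \<noteq> 0" and z: "z \<noteq> 0"
    and T: "(\<lambda>n. truncated_theta q p z (int n) (int n)) \<longlonglongrightarrow> T"
  shows "jacobi_theta p z = T * qpoch_inf q q ^ 2"
proof -
  define P where "P = qpoch_inf q q"
  have P: "P \<noteq> 0" unfolding P_def by (rule qpoch_inf_self_nonzero[OF q])
  obtain K where K: "K > 0" "\<And>n. norm (inv_qpoch q n) \<le> K" using inv_qpoch_bounds[OF q] by metis
  have "((\<lambda>r. theta_term p z r * (1 / P * (1 / P))) has_sum T) UNIV"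
  proof (rule has_sum_dominated_limit[OF has_sum_truncated_theta T])
    show "(\<lambda>n. truncated_theta_term q p z (int n) (int n) r) \<longlonglongrightarrow> theta_term p z r * (1 / P * (1 / P))"
      for r
      unfolding truncated_theta_term_def P_def
      using inv_qpoch_tendsto[OF q, of "- r"]
      by (intro tendsto_mult tendsto_const inv_qpoch_tendsto q) auto
    show "(\<lambda>r. theta_term (norm p) (norm z) r * (K * K)) summable_on UNIV"
      using p z by (intro summable_on_cmult_left summable_on_theta_term_real) auto
    show "norm (truncated_theta_term q p z (int n) (int n) r) \<le>
        theta_term (norm p) (norm z) r * (K * K)" for n r
      unfolding truncated_theta_term_def norm_mult norm_theta_term using K
      by (intro mult_left_mono mult_mono theta_term_nonneg) auto
  qed
  moreover have "((\<lambda>r. theta_term p z r * (1 / P * (1 / P))) has_sum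
      jacobi_theta p z * (1 / P * (1 / P))) UNIV"
    by (intro has_sum_cmult_left has_sum_jacobi_theta p z)
  ultimately have "T = jacobi_theta p z * (1 / P * (1 / P))" by (rule has_sum_unique)
  thus ?thesis using P by (simp add: P_def power2_eq_square)
qed

subsection \<open>The Jacobi triple product\<close>

lemma truncated_theta_jacobi_rec:
  assumes q: "norm q < 1" "q \<noteq> 0" and z: "z \<noteq> 0"
  shows "(1 - (q^2) powi (s + t)) * truncated_theta (q^2) q z s t =
           (1 + q * z * (q^2) powi (s - 1)) * truncated_theta (q^2) q z (s - 1) t"
proof -
  define Q where "Q = q^2"
  define W where "W = truncated_theta Q q"
  have Q: "norm Q < 1" "Q \<noteq> 0" using q by (auto simp: Q_def norm_power_less_1)
  have "W z s t = W z (s - 1) t + Q powi s * W (z / Q) s t"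
    unfolding W_def by (rule truncated_theta_rec_left[OF Q])
  also have "W (z / Q) s t = W (z / Q) s (t - 1) + Q powi t * W z s t"
    using truncated_theta_rec_right[OF Q, of q "z / Q" s t] Q by (simp add: W_def)
  also have "W (z / Q) s (t - 1) = q * (z / Q) * W z (s - 1) t"
    using truncated_theta_shift[of q "z / Q" Q s "t - 1"] q z Q by (simp add: W_def Q_def)
  finally have "(1 - Q powi (s + t)) * W z s t = (1 + q * z * (Q powi s / Q)) * W z (s - 1) t"
    using Q by (simp add: power_int_add algebra_simps)
  also have "Q powi s / Q = Q powi (s - 1)" using Q by (simp add: power_int_diff)
  finally show ?thesis by (simp add: W_def Q_def)
qed

lemma truncated_theta_finite_jacobi:
  assumes q: "norm q < 1" "q \<noteq> 0" and z: "z \<noteq> 0"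
  shows "truncated_theta (q^2) q z (int m) (int n) =
           qpoch (- (q * z)) (q^2) m * qpoch (- (q / z)) (q^2) n / qpoch (q^2) (q^2) (m + n)"
proof -
  define Q where "Q = q^2"
  define W where "W m n z = truncated_theta Q q z (int m) (int n)" for m n z
  have Q: "norm Q < 1" using q by (simp add: Q_def norm_power_less_1)
  have W_Suc: "W (Suc m) n z = (1 + q * z * Q ^ m) * W m n z / (1 - Q ^ Suc (m + n))"
    if "z \<noteq> 0" for m n z
  proof -
    have "(1 - Q powi (int (Suc (m + n)))) * W (Suc m) n z = (1 + q * z * Q powi (int m)) * W m n z"
      using truncated_theta_jacobi_rec[OF q that, of "int (Suc m)" "int n"]
      by (simp add: W_def Q_def add.assoc)
    thus ?thesis
      using one_minus_power_int_nonzero[OF Q, of "int (Suc (m + n))"]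
      unfolding power_int_of_nat by (simp add: eq_divide_eq mult.commute)
  qed
  have W_commute: "W m n z = W n m (1 / z)" for m n z
    unfolding W_def by (rule truncated_theta_reflect)
  have W_0: "W 0 n z = qpoch (- (q / z)) Q n / qpoch Q Q n"
  proof (induction n)
    case (Suc n)
    have "W 0 (Suc n) z = (1 + q / z * Q ^ n) * W 0 n z / (1 - Q ^ Suc n)"
      using W_Suc[of "1 / z" n 0] z by (simp add: W_commute[of 0])
    thus ?case unfolding Suc by (simp add: qpoch_Suc)
  qed (simp add: W_def truncated_theta_0_0)
  have "W m n z = qpoch (- (q * z)) Q m * qpoch (- (q / z)) Q n / qpoch Q Q (m + n)"
  proof (induction m)
    case (Suc m)
    show ?case unfolding W_Suc[OF z] Suc by (simp add: qpoch_Suc)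
  qed (simp add: W_0)
  thus ?thesis by (simp add: W_def Q_def)
qed

theorem jacobi_triple_product:
  assumes q: "norm q < 1" "q \<noteq> 0" and z: "z \<noteq> 0"
  shows "jacobi_theta q z =
           qpoch_inf (- (q * z)) (q^2) * qpoch_inf (- (q / z)) (q^2) * qpoch_inf (q^2) (q^2)"
proof -
  define Q where "Q = q^2"
  have Q: "norm Q < 1" using q by (simp add: Q_def norm_power_less_1)
  have nz: "qpoch_inf Q Q \<noteq> 0" by (rule qpoch_inf_self_nonzero[OF Q])
  have "filterlim (\<lambda>n::nat. n + n) sequentially sequentially"
    by (rule filterlim_at_top_mono[OF filterlim_ident]) simp
  hence "(\<lambda>n. qpoch Q Q (n + n)) \<longlonglongrightarrow> qpoch_inf Q Q"
    by (rule filterlim_compose[OF qpoch_tendsto_qpoch_inf[OF Q]])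
  hence "(\<lambda>n. qpoch (- (q * z)) Q n * qpoch (- (q / z)) Q n / qpoch Q Q (n + n))
      \<longlonglongrightarrow> qpoch_inf (- (q * z)) Q * qpoch_inf (- (q / z)) Q / qpoch_inf Q Q"
    by (intro tendsto_divide tendsto_mult qpoch_tendsto_qpoch_inf Q nz)
  hence "jacobi_theta q z =
      qpoch_inf (- (q * z)) Q * qpoch_inf (- (q / z)) Q / qpoch_inf Q Q * qpoch_inf Q Q ^ 2"
    by (intro jacobi_theta_eq_truncated_limit Q q z)
       (simp only: Q_def truncated_theta_finite_jacobi[OF q z])
  thus ?thesis using nz by (simp add: Q_def power2_eq_square[of "qpoch_inf _ _"])
qed

lemma jacobi_theta_self:
  assumes q: "norm q < 1" "q \<noteq> 0"
  shows "jacobi_theta q q = 2 * qpoch_inf (q^4) (q^4) ^ 2 / qpoch_inf (q^2) (q^2)"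
proof -
  have q2: "norm (q^2) < 1" using q by (intro norm_power_less_1) auto
  have "jacobi_theta q q = qpoch_inf (- (q^2)) (q^2) * qpoch_inf (- 1) (q^2)
      * qpoch_inf (q^2) (q^2)"
    using jacobi_triple_product[OF q q(2)] q by (simp add: power2_eq_square)
  also have "qpoch_inf (- 1) (q^2) = 2 * qpoch_inf (- (q^2)) (q^2)"
    using qpoch_inf_rec[OF q2, of "- 1"] by simp
  finally have "jacobi_theta q q * qpoch_inf (q^2) (q^2) =
      2 * (qpoch_inf (q^2) (q^2) * qpoch_inf (- (q^2)) (q^2)) ^ 2"
    by (simp only: power2_eq_square mult_ac)
  also have "qpoch_inf (q^2) (q^2) * qpoch_inf (- (q^2)) (q^2) = qpoch_inf (q^4) (q^4)"
    using qpoch_inf_mult_uminus[OF q2, of "q^2"] by simp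
  finally show ?thesis using qpoch_inf_self_nonzero[OF q2] by (simp add: field_simps)
qed

lemma jacobi_theta_square_base_self:
  assumes q: "norm q < 1" "q \<noteq> 0"
  shows "jacobi_theta (q^2) q = qpoch_inf (q^2) (q^2) ^ 2 / qpoch_inf q q"
proof -
  define Q where "Q = q^2"
  have Q: "norm Q < 1" "Q \<noteq> 0" "Q^2 = q^4" using q by (auto simp: Q_def norm_power_less_1)
  have "jacobi_theta Q q = qpoch_inf (- q) (Q^2) * qpoch_inf (- q * Q) (Q^2)
      * qpoch_inf (Q^2) (Q^2)"
    using jacobi_triple_product[OF Q(1,2) q(2)] q by (simp add: Q_def power2_eq_square mult_ac)
  also have "\<dots> = qpoch_inf (- q) Q * qpoch_inf (Q^2) (Q^2)"
    by (simp only: qpoch_inf_split_parity[OF Q(1), of "- q"])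
  finally have "jacobi_theta Q q = qpoch_inf (- q) Q * qpoch_inf (Q^2) (Q^2)" .
  moreover have "qpoch_inf q Q * qpoch_inf (- q) Q = qpoch_inf Q (Q^2)"
    using qpoch_inf_mult_uminus[OF Q(1), of q] by (simp flip: Q_def)
  moreover have "qpoch_inf Q Q = qpoch_inf Q (Q^2) * qpoch_inf (Q^2) (Q^2)"
    using qpoch_inf_split_parity[OF Q(1), of Q] by (simp only: power2_eq_square)
  moreover have "qpoch_inf q q = qpoch_inf q Q * qpoch_inf Q Q"
    using qpoch_inf_split_parity[OF q(1), of q] by (simp add: Q_def power2_eq_square)
  ultimately have "jacobi_theta Q q * qpoch_inf q q = qpoch_inf Q Q * qpoch_inf Q Q"
    by (metis mult.assoc mult.commute)
  hence "jacobi_theta Q q = qpoch_inf Q Q ^ 2 / qpoch_inf q q"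
    using qpoch_inf_self_nonzero[OF q(1)]
    by (simp add: eq_divide_eq power2_eq_square[of "qpoch_inf _ _"])
  thus ?thesis by (simp add: Q_def)
qed

lemma jacobi_theta_minus_1:
  assumes q: "norm q < 1" "q \<noteq> 0"
  shows "jacobi_theta q (- 1) = qpoch_inf q q ^ 2 / qpoch_inf (q^2) (q^2)"
proof -
  have "jacobi_theta q (- 1) = qpoch_inf q (q^2) * qpoch_inf q (q^2) * qpoch_inf (q^2) (q^2)"
    using jacobi_triple_product[OF q, of "- 1"] by simp
  moreover have "qpoch_inf q q = qpoch_inf q (q^2) * qpoch_inf (q^2) (q^2)"
    using qpoch_inf_split_parity[OF q(1), of q] by (simp add: power2_eq_square)
  moreover have "qpoch_inf (q^2) (q^2) \<noteq> 0"
    using q by (intro qpoch_inf_self_nonzero norm_power_less_1) auto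
  ultimately show ?thesis by (simp add: power2_eq_square[of "qpoch_inf _ _"] power_mult_distrib)
qed

subsection \<open>Bressoud sums\<close>

text \<open>The summands of \<open>truncated_theta q p (- p) s (s + 1)\<close> at \<open>r\<close> and \<open>- 1 - r\<close> cancel.\<close>
lemma truncated_theta_uminus_eq_0:
  assumes "p \<noteq> 0"
  shows "truncated_theta q p (- p) s (s + 1) = 0"
proof -
  have "truncated_theta q p (- p) s (s + 1) = truncated_theta q p (- (1 / p)) (s + 1) s"
    using truncated_theta_reflect[of q p "- p"] by simp
  also have "\<dots> = - truncated_theta q p (- p) s (s + 1)"
    using truncated_theta_shift[of p "- (1 / p)" q "s + 1" s] assms by (simp add: power2_eq_square)
  finally show ?thesis by simp
qed

lemma truncated_theta_minus_1:
  assumes q: "norm q < 1" "q \<noteq> 0" and e: "e = 0 \<or> e = 1"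
  shows "truncated_theta q q (- 1) s (s + e) = inv_qpoch (q^2) s"
proof -
  define W where "W = truncated_theta q q (- 1)"
  have W_Suc: "W s (s + 1) = W s s" for s
    using truncated_theta_rec_right[OF q, of q "- 1" s "s + 1"] q
    by (simp add: W_def truncated_theta_uminus_eq_0)
  have rec: "(1 - (q^2) powi s) * W s s = W (s - 1) (s - 1)" for s
  proof -
    have "truncated_theta q q (- (1 / q)) s (s - 1) = 0"
      using truncated_theta_reflect[of q q "- (1 / q)" s "s - 1"]
        truncated_theta_uminus_eq_0[OF q(2), of q "s - 1"] by simp
    hence "truncated_theta q q (- (1 / q)) s s = q powi s * W s s"
      using truncated_theta_rec_right[OF q, of q "- (1 / q)" s s] q by (simp add: W_def)
    hence "W s s = W (s - 1) s + q powi s * (q powi s * W s s)"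
      using truncated_theta_rec_left[OF q, of q "- 1" s s] by (simp add: W_def)
    moreover have "q powi s * q powi s = (q^2) powi s"
      by (simp add: power2_eq_square power_int_mult_distrib)
    ultimately have "(1 - (q^2) powi s) * W s s = W (s - 1) s"
      by (simp add: left_diff_distrib diff_eq_eq flip: mult.assoc)
    also have "\<dots> = W (s - 1) (s - 1)" using W_Suc[of "s - 1"] by simp
    finally show ?thesis .
  qed
  have "norm (q^2) < 1" using q by (intro norm_power_less_1) auto
  hence "W s s = W 0 0 * inv_qpoch (q^2) s"
    by (rule inv_qpoch_unique) (auto simp: rec, simp add: W_def truncated_theta_eq_0)
  hence "W s s = inv_qpoch (q^2) s" by (simp add: W_def truncated_theta_0_0)
  moreover have "W s (s + e) = W s s" using e W_Suc by auto
  ultimately show ?thesis by (simp add: W_def)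
qed

lemma has_sum_bailey_limit:
  assumes q: "norm q < 1" "q \<noteq> 0"
    and S: "((\<lambda>r. q powi (r^2 + e * r) * \<alpha> r) has_sum S) UNIV"
  shows "((\<lambda>(r, N). q powi (N^2 + e * N) * \<alpha> r * (inv_qpoch q (N - r) * inv_qpoch q (N + e + r)))
           has_sum S / qpoch_inf q q) UNIV"
  using has_sum_durfee_expand[OF q S, of "\<lambda>r. 2 * r + e"]
proof (rule has_sum_reindex_UNIV[where i = "\<lambda>(r, m). (r, m + r)" and j = "\<lambda>(r, N). (r, N - r)"])
  fix x :: "int \<times> int"
  obtain r N where x: "x = (r, N)" by (cases x)
  have exponent: "q powi (N^2 + e * N) = q powi (r^2 + e * r) * q powi ((N - r) * (N + e + r))"
    using q by (intro power_int_mult_eqI[symmetric]) (auto simp: power2_eq_square algebra_simps)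
  have index: "N - r + (2 * r + e) = N + e + r" by simp
  show "(case x of (r, N) \<Rightarrow> q powi (N^2 + e * N) * \<alpha> r
      * (inv_qpoch q (N - r) * inv_qpoch q (N + e + r))) =
      (case case x of (r, N) \<Rightarrow> (r, N - r) of (r, m) \<Rightarrow>
        q powi (r^2 + e * r) * \<alpha> r * durfee_term q m (m + (2 * r + e)))"
    unfolding x prod.case durfee_term_def exponent index by (simp only: mult_ac)
qed auto

lemma vandermonde_term_bailey:
  assumes "q \<noteq> 0"
  shows "q powi (r^2 + e * r) * vandermonde_term q (N - r) (N + e + r) (N - s) =
           q powi (s^2 + e * s) * inv_qpoch q (N - s) * (inv_qpoch q (s - r) * inv_qpoch q (s + e + r))"
proof -
  have exponent: "q powi (s^2 + e * s) = q powi (r^2 + e * r) * q powi ((s - r) * (s + e + r))"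
    using assms by (intro power_int_mult_eqI[symmetric]) (auto simp: power2_eq_square algebra_simps)
  have indices: "N - r - (N - s) = s - r" "N + e + r - (N - s) = s + e + r" by simp_all
  show ?thesis
    unfolding vandermonde_term_def durfee_term_def indices exponent by (simp only: mult_ac)
qed

text \<open>Two steps of the Bailey chain for a Bailey pair \<open>(\<alpha>, \<beta>)\<close> relative to \<open>q powi e\<close>, the second one
  in the limit.\<close>
lemma has_sum_bailey_chain:
  fixes \<alpha> \<beta> :: "int \<Rightarrow> complex"
  assumes q: "norm q < 1" "q \<noteq> 0"
    and pair: "\<And>s. ((\<lambda>r. \<alpha> r * (inv_qpoch q (s - r) * inv_qpoch q (s + e + r))) has_sum \<beta> s) UNIV"
    and S: "((\<lambda>r. q powi (2 * (r^2 + e * r)) * \<alpha> r) has_sum S) UNIV"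
  shows "((\<lambda>(N, s). q powi (N^2 + e * N) * q powi (s^2 + e * s) * \<beta> s * inv_qpoch q (N - s))
           has_sum S / qpoch_inf q q) UNIV"
proof -
  define c where "c = (\<lambda>(r, N). q powi (N^2 + e * N) * (q powi (r^2 + e * r) * \<alpha> r))"
  define a b :: "int \<times> int \<Rightarrow> int" where "a = (\<lambda>(r, N). N - r)" and "b = (\<lambda>(r, N). N + e + r)"
  have "q powi (r^2 + e * r) * q powi (r^2 + e * r) = q powi (2 * (r^2 + e * r))" for r
    using q by (intro power_int_mult_eqI) auto
  hence "((\<lambda>r. q powi (r^2 + e * r) * (q powi (r^2 + e * r) * \<alpha> r)) has_sum S) UNIV"
    using S by (simp flip: mult.assoc)
  from has_sum_bailey_limit[OF q this]
  have "((\<lambda>x. c x * (inv_qpoch q (a x) * inv_qpoch q (b x))) has_sum S / qpoch_inf q q) UNIV"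
    by (simp add: a_def b_def c_def case_prod_unfold)
  hence expanded: "((\<lambda>(x, i). c x * vandermonde_term q (a x) (b x) i) has_sum
      S / qpoch_inf q q) UNIV"
    by (rule has_sum_vandermonde_expand[OF q])
  define d where "d N s = q powi (N^2 + e * N) * q powi (s^2 + e * s) * inv_qpoch q (N - s)" for N s
  define f where "f = (\<lambda>((N, s), r). d N s
      * (\<alpha> r * (inv_qpoch q (s - r) * inv_qpoch q (s + e + r))))"
  have f: "f ((N, s), r) = c (r, N) * vandermonde_term q (a (r, N)) (b (r, N)) (N - s)" for N s r
    using vandermonde_term_bailey[OF q(2), of r e N s]
    by (simp add: f_def d_def c_def a_def b_def mult_ac)
  have "(f has_sum S / qpoch_inf q q) UNIV"
    by (rule has_sum_reindex_UNIV[OF expanded, where i = "\<lambda>((r, N), i). ((N, N - i), r)"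
          and j = "\<lambda>((N, s), r). ((r, N), N - s)"]) (auto simp: f)
  hence "((\<lambda>(N, s). d N s * \<beta> s) has_sum S / qpoch_inf q q) UNIV"
  proof (rule has_sum_collapse)
    show "((\<lambda>r. f (x, r)) has_sum (case x of (N, s) \<Rightarrow> d N s * \<beta> s)) UNIV" for x
      by (cases x) (simp add: f_def has_sum_cmult_right pair)
  qed
  thus ?thesis by (simp add: d_def mult_ac)
qed

lemma has_sum_bressoud:
  assumes q: "norm q < 1" "q \<noteq> 0" and e: "e = 0 \<or> e = 1"
  shows "((\<lambda>(N, s). q powi (N^2 + e * N) * q powi (s^2 + e * s) * inv_qpoch (q^2) s
               * inv_qpoch q (N - s))
           has_sum jacobi_theta (q^3) (- (q powi (2 * e))) / qpoch_inf q q) UNIV"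
proof (rule has_sum_bailey_chain[OF q])
  fix s
  show "((\<lambda>r. theta_term q (- 1) r * (inv_qpoch q (s - r) * inv_qpoch q (s + e + r))) has_sum
      inv_qpoch (q^2) s) UNIV"
    using has_sum_truncated_theta[of q q "- 1" s "s + e"]
    by (simp add: truncated_theta_minus_1[OF q e] truncated_theta_term_def[abs_def])
next
  have theta: "theta_term (q^3) (- (q powi (2 * e))) r =
      q powi (2 * (r^2 + e * r)) * theta_term q (- 1) r" for r
  proof -
    have "(q^3) powi (r^2) * (q powi (2 * e)) powi r = q powi (2 * (r^2 + e * r)) * q powi (r^2)"
      using q
      by (simp add: power_int_power power_int_mult[symmetric] power_int_add[symmetric] algebra_simps)
    moreover have "(- (q powi (2 * e))) powi r = (q powi (2 * e)) powi r * (- 1) powi r"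
      by (subst power_int_mult_distrib[symmetric]) simp
    ultimately show ?thesis by (simp add: theta_term_def)
  qed
  have "(theta_term (q^3) (- (q powi (2 * e))) has_sum
      jacobi_theta (q^3) (- (q powi (2 * e)))) UNIV"
    using q by (intro has_sum_jacobi_theta) (auto simp: norm_power_less_1)
  thus "((\<lambda>r. q powi (2 * (r^2 + e * r)) * theta_term q (- 1) r) has_sum
      jacobi_theta (q^3) (- (q powi (2 * e)))) UNIV"
    by (simp only: theta[symmetric])
qed

subsection \<open>Reciprocal q-factorials over the squared base\<close>

text \<open>For fixed \<open>n\<close> these are the contributions to the coefficient of \<open>t ^ n\<close> in
  \<open>(-t; q^2)\<^sub>\<infinity> (-qt; q^2)\<^sub>\<infinity> / (t^2; q^2)\<^sub>\<infinity> = 1 / (t; q)\<^sub>\<infinity>\<close>.\<close>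
definition square_base_term :: "complex \<Rightarrow> int \<Rightarrow> int \<times> int \<Rightarrow> complex" where
  "square_base_term q n = (\<lambda>(m, x). theta_term q (1 / q) x * theta_term q 1 (n - 2 * m - x) *
     (inv_qpoch (q^2) x * inv_qpoch (q^2) (n - 2 * m - x) * inv_qpoch (q^2) m))"

lemma theta_term_inverse_base: "q \<noteq> 0 \<Longrightarrow> theta_term q (1 / q) x = q powi (x^2 - x)"
  by (simp add: theta_term_def power_int_diff power_int_divide_distrib)

lemma square_base_term_eq_0:
  assumes "m < 0 \<or> n < m \<or> x < 0 \<or> n < x"
  shows "square_base_term q n (m, x) = 0"
proof -
  have "m < 0 \<or> x < 0 \<or> n - 2 * m - x < 0" using assms by linarith
  thus ?thesis by (auto simp: square_base_term_def)
qed

lemma summable_square_base_term: "(\<lambda>p. c p * square_base_term q n p) summable_on UNIV"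
proof (rule finite_nonzero_values_imp_summable_on, rule finite_subset)
  show "{p \<in> UNIV. c p * square_base_term q n p \<noteq> 0} \<subseteq> {0..n} \<times> {0..n}"
  proof
    fix p assume "p \<in> {p \<in> UNIV. c p * square_base_term q n p \<noteq> 0}"
    moreover obtain m x where p: "p = (m, x)" by (cases p)
    ultimately have "\<not> (m < 0 \<or> n < m \<or> x < 0 \<or> n < x)" using square_base_term_eq_0 by auto
    thus "p \<in> {0..n} \<times> {0..n}" by (auto simp: p)
  qed
qed simp

lemma square_base_term_swap:
  assumes "q \<noteq> 0"
  shows "q powi n * square_base_term q n (m, n - 2 * m - x) =
      q powi (2 * (m + x)) * square_base_term q n (m, x)"
proof -
  define y where "y = n - 2 * m - x"
  have n: "n = x + y + 2 * m" by (simp add: y_def)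
  have "q powi n * (q powi (y^2 - y) * q powi (x^2)) =
      q powi (2 * (m + x)) * (q powi (x^2 - x) * q powi (y^2))"
    using assms by (simp add: n power_int_add[symmetric] algebra_simps)
  moreover have "n - 2 * m - y = x" by (simp add: y_def)
  ultimately show ?thesis
    using assms unfolding square_base_term_def prod.case y_def[symmetric]
    by (simp add: theta_term_inverse_base) (simp add: theta_term_def mult_ac)
qed

lemma square_base_term_rec:
  assumes q: "norm q < 1" "q \<noteq> 0"
  shows "square_base_term q n (m, x) = q powi (2 * (m + x)) * square_base_term q n (m, x)
           + (square_base_term q (n - 2) (m - 1, x)
             + q powi (2 * (m + (x - 1))) * square_base_term q (n - 1) (m, x - 1))"
proof -
  define I where "I = inv_qpoch (q^2)"
  define E where "E x = q powi (x^2 - x)" for x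
  define y where "y = n - 2 * m - x"
  define Y where "Y = theta_term q 1 y * I y"
  have I: "I k = q powi (2 * k) * I k + I (k - 1)" for k
  proof -
    have "(q^2) powi k = q powi (2 * k)" by (simp add: power_int_mult)
    thus ?thesis using inv_qpoch_rec[of "q^2" k] q by (simp add: I_def norm_power_less_1 algebra_simps)
  qed
  have E: "q powi (2 * (m + (x - 1))) * E (x - 1) = q powi (2 * m) * E x"
    unfolding E_def using q by (simp add: power_int_add[symmetric] power2_eq_square algebra_simps)
  have "square_base_term q n (m, x) = E x * I x * Y * I m"
    "square_base_term q (n - 2) (m - 1, x) = E x * I x * Y * I (m - 1)"
    "square_base_term q (n - 1) (m, x - 1) = E (x - 1) * I (x - 1) * Y * I m"
    using q by (simp_all add: square_base_term_def theta_term_inverse_base I_def E_def Y_def y_def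
        algebra_simps)
  moreover have "E x * I x * Y * I m =
      q powi (2 * m) * E x * I x * Y * I m + E x * I x * Y * I (m - 1)"
    by (subst I[of m]) (simp add: algebra_simps)
  moreover have "q powi (2 * m) * E x * I x * Y * I m =
      q powi (2 * m) * q powi (2 * x) * E x * I x * Y * I m + q powi (2 * m) * E x * I (x - 1) * Y * I m"
    by (subst I[of x]) (simp add: algebra_simps)
  moreover have "q powi (2 * (m + x)) = q powi (2 * m) * q powi (2 * x)"
    using q by (simp add: power_int_add[symmetric] algebra_simps)
  ultimately show ?thesis by (simp only: E[symmetric]) (simp add: mult_ac)
qed

lemma has_sum_weighted_square_base_term:
  assumes "q \<noteq> 0"
  shows "((\<lambda>(m, x). q powi (2 * (m + x)) * square_base_term q n (m, x)) has_sum
           q powi n * infsum (square_base_term q n) UNIV) UNIV"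
proof -
  have "(square_base_term q n has_sum infsum (square_base_term q n) UNIV) UNIV"
    using summable_square_base_term[of "\<lambda>_. 1"] by simp
  thus ?thesis
    by (rule has_sum_reindex_UNIV[OF has_sum_cmult_right, where i = "\<lambda>(m, x). (m, n - 2 * m - x)"
          and j = "\<lambda>(m, x). (m, n - 2 * m - x)"]) (auto simp: square_base_term_swap[OF assms])
qed

lemma infsum_square_base_term_rec:
  assumes q: "norm q < 1" "q \<noteq> 0"
  defines "A \<equiv> \<lambda>n. infsum (square_base_term q n) UNIV"
  shows "A n = q powi n * A n + (A (n - 2) + q powi (n - 1) * A (n - 1))"
proof -
  have A: "(square_base_term q n has_sum A n) UNIV" for n
    using summable_square_base_term[of "\<lambda>_. 1"] by (simp add: A_def)
  have weighted: "((\<lambda>(m, x). q powi (2 * (m + x)) * square_base_term q n (m, x)) has_sum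
      q powi n * A n) UNIV" for n
    unfolding A_def by (rule has_sum_weighted_square_base_term[OF q(2)])
  have shift_m: "((\<lambda>(m, x). square_base_term q (n - 2) (m - 1, x)) has_sum A (n - 2)) UNIV"
    by (rule has_sum_reindex_UNIV[OF A, where i = "\<lambda>(m, x). (m + 1, x)"
          and j = "\<lambda>(m, x). (m - 1, x)"]) auto
  have shift_x: "((\<lambda>(m, x). q powi (2 * (m + (x - 1)))
      * square_base_term q (n - 1) (m, x - 1)) has_sum
      q powi (n - 1) * A (n - 1)) UNIV"
    by (rule has_sum_reindex_UNIV[OF weighted, where i = "\<lambda>(m, x). (m, x + 1)"
          and j = "\<lambda>(m, x). (m, x - 1)"]) auto
  have "((\<lambda>(m, x). q powi (2 * (m + x)) * square_base_term q n (m, x)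
      + (square_base_term q (n - 2) (m - 1, x)
         + q powi (2 * (m + (x - 1))) * square_base_term q (n - 1) (m, x - 1)))
      has_sum q powi n * A n + (A (n - 2) + q powi (n - 1) * A (n - 1))) UNIV"
    using has_sum_add[OF weighted has_sum_add[OF shift_m shift_x]] by (simp only: case_prod_unfold)
  hence "(square_base_term q n has_sum
      q powi n * A n + (A (n - 2) + q powi (n - 1) * A (n - 1))) UNIV"
    by (simp only: square_base_term_rec[OF q, symmetric] case_prod_eta)
  with A show ?thesis by (rule has_sum_unique)
qed

lemma has_sum_square_base_term:
  assumes q: "norm q < 1" "q \<noteq> 0"
  shows "(square_base_term q n has_sum inv_qpoch q n) UNIV"
proof -
  define A where "A n = infsum (square_base_term q n) UNIV" for n
  have A_neg: "A n = 0" if "n < 0" for n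
    unfolding A_def by (rule infsum_0) (use that in \<open>auto intro!: square_base_term_eq_0\<close>)
  have "(1 - q powi n) * A n = A (n - 1)" for n
  proof (cases "n < 0")
    case False
    hence "n \<ge> 0" by simp
    thus ?thesis
    proof (induction n rule: int_ge_induct)
      case (step n)
      thus ?case
        using infsum_square_base_term_rec[OF q, of "n + 1"] by (simp add: A_def algebra_simps)
    qed (simp add: A_neg)
  qed (simp add: A_neg)
  hence "A n = A 0 * inv_qpoch q n" by (intro inv_qpoch_unique q A_neg)
  moreover have "(square_base_term q 0 has_sum 1) UNIV"
  proof (rule has_sum_finite_neutralI[of "{(0, 0)}"])
    show "square_base_term q 0 p = 0" if "p \<in> UNIV - {(0, 0)}" for p
      using that by (cases p) (auto intro!: square_base_term_eq_0)
  qed (auto simp: square_base_term_def theta_term_def)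
  hence "A 0 = 1" unfolding A_def by (rule infsumI)
  moreover have "(square_base_term q n has_sum A n) UNIV"
    using summable_square_base_term[of "\<lambda>_. 1"] by (simp add: A_def)
  ultimately show ?thesis by simp
qed

lemma norm_square_base_term_le:
  assumes q: "norm q < 1" "q \<noteq> 0"
    and K: "K > 0" "\<And>n. norm (inv_qpoch (q^2) n) \<le> K"
    and L: "L > 0" "\<And>n. n \<ge> 0 \<Longrightarrow> 1 \<le> L * norm (inv_qpoch q n)"
  shows "norm (square_base_term q n (m, x)) \<le> L * K^3 * norm (inv_qpoch q n) *
           (theta_term (norm q) (1 / norm q) x * theta_term (norm q) 1 (n - 2 * m - x))"
proof (cases "m < 0 \<or> n < m \<or> x < 0 \<or> n < x")
  case True
  thus ?thesis using K L by (simp add: square_base_term_eq_0 theta_term_nonneg)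
next
  case False
  define t where "t = theta_term (norm q) (1 / norm q) x * theta_term (norm q) 1 (n - 2 * m - x)"
  have t: "0 \<le> t" by (simp add: t_def theta_term_nonneg)
  have "norm (square_base_term q n (m, x)) = t * (norm (inv_qpoch (q^2) x) *
      norm (inv_qpoch (q^2) (n - 2 * m - x)) * norm (inv_qpoch (q^2) m))"
    by (simp add: square_base_term_def norm_mult norm_theta_term norm_divide t_def)
  also have "\<dots> \<le> t * (K * K * K)"
    using K t by (intro mult_left_mono mult_mono) auto
  also have "\<dots> \<le> L * norm (inv_qpoch q n) * (t * (K * K * K))"
    using mult_right_mono[OF L(2)[of n], of "t * (K * K * K)"] False K t by simp
  finally show ?thesis by (simp add: t_def power3_eq_cube mult_ac)
qed

lemma has_sum_square_base_expand:
  assumes q: "norm q < 1" "q \<noteq> 0" and S: "((\<lambda>x. c x * inv_qpoch q (n x)) has_sum S) UNIV"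
  shows "((\<lambda>(x, p). c x * square_base_term q (n x) p) has_sum S) UNIV"
proof -
  have "norm (q^2) < 1" using q by (intro norm_power_less_1) auto
  then obtain K where K: "K > 0" "\<And>n. norm (inv_qpoch (q^2) n) \<le> K" using inv_qpoch_bounds by metis
  obtain L where L: "L > 0" "\<And>n. n \<ge> 0 \<Longrightarrow> 1 \<le> L * norm (inv_qpoch q n)"
    using inv_qpoch_bounds[OF q(1)] by metis
  show ?thesis
  proof (rule has_sum_expand[OF S, where \<phi> = "\<lambda>x (m, y). (y, n x - 2 * m - y)" and C = "L * K^3"
        and h = "\<lambda>(x, y). theta_term (norm q) (1 / norm q) x * theta_term (norm q) 1 y"])
    show "(\<lambda>(x, y). theta_term (norm q) (1 / norm q) x * theta_term (norm q) 1 y) summable_on UNIV"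
      using q by (intro summable_on_theta_product) auto
    fix x p
    show "norm (square_base_term q (n x) p) \<le> L * K^3 * norm (inv_qpoch q (n x)) *
        (case case p of (m, y) \<Rightarrow> (y, n x - 2 * m - y) of (x, y) \<Rightarrow>
          theta_term (norm q) (1 / norm q) x * theta_term (norm q) 1 y)"
      using norm_square_base_term_le[OF q K L] by (cases p) simp
    show "inj (\<lambda>(m, y). (y, n x - 2 * m - y))" by (auto simp: inj_def)
  qed (auto simp: theta_term_nonneg intro: has_sum_square_base_term[OF q])
qed

subsection \<open>Double sums over the form \<open>a^2 - ab + b^2\<close>\<close>

definition pair_term :: "complex \<Rightarrow> complex \<Rightarrow> complex \<Rightarrow> int \<times> int \<Rightarrow> complex" where
  "pair_term q u v = (\<lambda>(a, b). q powi (a^2 - a * b + b^2) * u powi a * v powi b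
      * (inv_qpoch q a * inv_qpoch q b))"

definition pair_sum :: "complex \<Rightarrow> complex \<Rightarrow> complex \<Rightarrow> complex" where
  "pair_sum q u v = infsum (pair_term q u v) UNIV"

lemma norm_pair_term_le:
  assumes q: "norm q < 1" "q \<noteq> 0" and K: "\<And>n. norm (inv_qpoch q n) \<le> K"
  shows "norm (pair_term q u v (a, b)) \<le>
           K * K * (theta_term (sqrt (norm q)) (norm u) a * theta_term (sqrt (norm q)) (norm v) b)"
proof -
  have "norm q powi (a^2 - a * b + b^2) = ((sqrt (norm q))^2) powi (a^2 - a * b + b^2)" by simp
  also have "\<dots> = sqrt (norm q) powi (2 * (a^2 - a * b + b^2))"
    by (simp only: power_int_power of_nat_numeral)
  also have "\<dots> \<le> sqrt (norm q) powi (a^2 + b^2)"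
  proof (rule power_int_decreasing)
    have "a^2 + b^2 + (a - b)^2 = 2 * (a^2 - a * b + b^2)"
      by (simp add: power2_eq_square algebra_simps)
    thus "a^2 + b^2 \<le> 2 * (a^2 - a * b + b^2)" by (metis le_add_same_cancel1 zero_le_power2)
  qed (use q in auto)
  also have "\<dots> = sqrt (norm q) powi (a^2) * sqrt (norm q) powi (b^2)"
    using q by (simp add: power_int_add)
  finally have "norm q powi (a^2 - a * b + b^2) * (norm u powi a * norm v powi b) \<le>
      sqrt (norm q) powi (a^2) * sqrt (norm q) powi (b^2) * (norm u powi a * norm v powi b)"
    by (rule mult_right_mono) simp
  also have "\<dots> = theta_term (sqrt (norm q)) (norm u) a * theta_term (sqrt (norm q)) (norm v) b"
    by (simp add: theta_term_def mult_ac)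
  finally have "norm q powi (a^2 - a * b + b^2) * (norm u powi a * norm v powi b) \<le>
      theta_term (sqrt (norm q)) (norm u) a * theta_term (sqrt (norm q)) (norm v) b" .
  moreover have "norm (inv_qpoch q a) * norm (inv_qpoch q b) \<le> K * K"
    using order_trans[OF norm_ge_zero K] by (intro mult_mono K) auto
  ultimately have "norm q powi (a^2 - a * b + b^2) * (norm u powi a * norm v powi b)
        * (norm (inv_qpoch q a) * norm (inv_qpoch q b)) \<le>
      theta_term (sqrt (norm q)) (norm u) a * theta_term (sqrt (norm q)) (norm v) b * (K * K)"
    by (rule mult_mono) (simp_all add: theta_term_nonneg)
  thus ?thesis by (simp add: pair_term_def norm_mult norm_power_int mult_ac)
qed

lemma has_sum_pair_sum:
  assumes q: "norm q < 1" "q \<noteq> 0" and uv: "u \<noteq> 0" "v \<noteq> 0"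
  shows "(pair_term q u v has_sum pair_sum q u v) UNIV"
proof -
  obtain K where K: "\<And>n. norm (inv_qpoch q n) \<le> K" using inv_qpoch_bounds[OF q(1)] by metis
  have "(\<lambda>p. norm (pair_term q u v p)) summable_on UNIV"
  proof (rule Infinite_Sum.abs_summable_on_comparison_test')
    show "(\<lambda>p. K * K * (case p of (a, b) \<Rightarrow>
        theta_term (sqrt (norm q)) (norm u) a * theta_term (sqrt (norm q)) (norm v) b)) summable_on UNIV"
      using q uv by (intro summable_on_cmult_right summable_on_theta_product) auto
    show "norm (pair_term q u v p) \<le> K * K * (case p of (a, b) \<Rightarrow>
        theta_term (sqrt (norm q)) (norm u) a * theta_term (sqrt (norm q)) (norm v) b)" for p
      using norm_pair_term_le[OF q K] by (cases p) simp
  qed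
  thus ?thesis unfolding pair_sum_def by (intro has_sum_infsum) (rule abs_summable_summable)
qed

lemma pair_sum_commute: "pair_sum q u v = pair_sum q v u"
  unfolding pair_sum_def
  by (rule infsum_reindex_bij_witness[where i = prod.swap and j = prod.swap])
     (auto simp: pair_term_def algebra_simps)

lemma pair_term_rec:
  assumes q: "norm q < 1" "q \<noteq> 0" and uv: "u \<noteq> 0" "v \<noteq> 0"
  shows "pair_term q u v (a, b) =
           pair_term q (u * q) v (a, b) + u * q * pair_term q (u * q^2) (v / q) (a - 1, b)"
proof -
  define E where "E a = q powi (a^2 - a * b + b^2)" for a
  have "inv_qpoch q a = q powi a * inv_qpoch q a + inv_qpoch q (a - 1)"
    using inv_qpoch_rec[OF q(1), of a] by (simp add: algebra_simps)
  hence "pair_term q u v (a, b) =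
      E a * u powi a * v powi b * ((q powi a * inv_qpoch q a + inv_qpoch q (a - 1)) * inv_qpoch q b)"
    by (simp add: pair_term_def E_def)
  also have "\<dots> = pair_term q (u * q) v (a, b) + E a * u powi a * v powi b
      * (inv_qpoch q (a - 1) * inv_qpoch q b)"
    by (simp add: pair_term_def E_def power_int_mult_distrib algebra_simps)
  also have "E a * u powi a * v powi b =
      u * q * (E (a - 1) * (u * q^2) powi (a - 1) * (v / q) powi b)"
  proof -
    have "a^2 - a * b + b^2 = 1 + ((a - 1)^2 - (a - 1) * b + b^2) + 2 * (a - 1) + - b"
      by (simp add: power2_eq_square algebra_simps)
    hence "E a = q * E (a - 1) * q powi (2 * (a - 1)) * q powi (- b)"
      unfolding E_def by (simp only: power_int_add[OF disjI1[OF q(2)]] power_int_1_right)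
    moreover have "q powi (2 * (a - 1)) = (q^2) powi (a - 1)"
      by (simp only: power_int_mult power_int_numeral)
    moreover have "u powi a = u * u powi (a - 1)" using uv by (simp add: power_int_diff)
    ultimately show ?thesis
      by (simp add: power_int_mult_distrib power_int_divide_distrib power_int_minus power_int_inverse
          divide_inverse)
  qed
  finally show ?thesis by (simp add: pair_term_def E_def mult.assoc)
qed

lemma pair_sum_rec:
  assumes q: "norm q < 1" "q \<noteq> 0" and uv: "u \<noteq> 0" "v \<noteq> 0"
  shows "pair_sum q u v = pair_sum q (u * q) v + u * q * pair_sum q (u * q^2) (v / q)"
proof -
  have "(pair_term q (u * q^2) (v / q) has_sum pair_sum q (u * q^2) (v / q)) UNIV"
    using q uv by (intro has_sum_pair_sum) auto
  hence "((\<lambda>(a, b). pair_term q (u * q^2) (v / q) (a - 1, b)) has_sum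
      pair_sum q (u * q^2) (v / q)) UNIV"
    by (rule has_sum_reindex_UNIV[where j = "\<lambda>(a, b). (a - 1, b)"
          and i = "\<lambda>(a, b). (a + 1, b)"]) auto
  hence shifted:
    "((\<lambda>p. u * q * (case p of (a, b) \<Rightarrow> pair_term q (u * q^2) (v / q) (a - 1, b))) has_sum
      u * q * pair_sum q (u * q^2) (v / q)) UNIV"
    by (rule has_sum_cmult_right)
  have "(pair_term q (u * q) v has_sum pair_sum q (u * q) v) UNIV"
    using q uv by (intro has_sum_pair_sum) auto
  from has_sum_add[OF this shifted]
  have "(pair_term q u v has_sum pair_sum q (u * q) v + u * q * pair_sum q (u * q^2) (v / q)) UNIV"
    by (rule has_sum_reindex_UNIV[where i = id and j = id]) (auto simp: pair_term_rec[OF assms])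
  with has_sum_pair_sum[OF assms] show ?thesis by (rule has_sum_unique)
qed

text \<open>On the diagonal \<open>b - a = n\<close> the exponent is \<open>n^2 + a (a + n)\<close>, and the sum over \<open>a\<close> is the Durfee
  identity.\<close>
lemma pair_sum_inverse:
  assumes q: "norm q < 1" "q \<noteq> 0" and z: "z \<noteq> 0"
  shows "pair_sum q (1 / z) z = jacobi_theta q z / qpoch_inf q q"
proof -
  have "((\<lambda>(n, a). theta_term q z n * durfee_term q a (a + n)) has_sum
      jacobi_theta q z / qpoch_inf q q) UNIV"
    by (rule has_sum_durfee_expand[OF q has_sum_jacobi_theta[OF q z]])
  moreover have "pair_term q (1 / z) z (a, a + n) = theta_term q z n * durfee_term q a (a + n)"
    for n a
  proof -
    have "q powi (a^2 - a * (a + n) + (a + n)^2) = q powi (n^2) * q powi (a * (a + n))"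
      using q by (intro power_int_mult_eqI[symmetric]) (auto simp: power2_eq_square algebra_simps)
    moreover have "(1 / z) powi a * z powi (a + n) = z powi n"
      using z by (simp add: power_int_add power_int_divide_distrib)
    ultimately show ?thesis by (simp add: pair_term_def theta_term_def durfee_term_def mult_ac)
  qed
  ultimately have "((\<lambda>(n, a). pair_term q (1 / z) z (a, a + n)) has_sum
      jacobi_theta q z / qpoch_inf q q) UNIV"
    by simp
  hence "(pair_term q (1 / z) z has_sum jacobi_theta q z / qpoch_inf q q) UNIV"
    by (rule has_sum_reindex_UNIV[where i = "\<lambda>(n, a). (a, a + n)"
          and j = "\<lambda>(a, b). (b - a, a)"]) auto
  thus ?thesis unfolding pair_sum_def by (rule infsumI)
qed

lemma pair_sum_one_self:
  assumes q: "norm q < 1" "q \<noteq> 0"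
  shows "pair_sum q 1 q = qpoch_inf (q^4) (q^4) ^ 2 / (qpoch_inf q q * qpoch_inf (q^2) (q^2))"
proof -
  have "2 * pair_sum q 1 q = pair_sum q (1 / q) q"
    using pair_sum_rec[OF q, of "1 / q" q] pair_sum_commute[of q q 1] q
    by (simp add: power2_eq_square)
  also have "\<dots> = 2 * (qpoch_inf (q^4) (q^4) ^ 2 / (qpoch_inf q q * qpoch_inf (q^2) (q^2)))"
    by (simp add: pair_sum_inverse[OF q q(2)] jacobi_theta_self[OF q])
  finally show ?thesis by (simp only: mult_cancel_left) simp
qed

lemma pair_sum_square_base_inverse_inverse:
  assumes q: "norm q < 1" "q \<noteq> 0"
  shows "pair_sum (q^2) (1 / q) (1 / q) = 2 * qpoch_inf (q^2) (q^2) / qpoch_inf q q"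
proof -
  define Q where "Q = q^2"
  have Q: "norm Q < 1" "Q \<noteq> 0" using q by (auto simp: Q_def norm_power_less_1)
  have "pair_sum Q (1 / q) (1 / q) = pair_sum Q q (1 / q) + q * pair_sum Q (q^3) (1 / q^3)"
    using pair_sum_rec[OF Q, of "1 / q" "1 / q"] q by (simp add: Q_def power_numeral_reduce)
  also have "pair_sum Q q (1 / q) = jacobi_theta Q q / qpoch_inf Q Q"
    using pair_sum_inverse[OF Q, of "1 / q"] q by (simp add: jacobi_theta_inverse)
  also have "pair_sum Q (q^3) (1 / q^3) = jacobi_theta Q (q^3) / qpoch_inf Q Q"
    using pair_sum_inverse[OF Q, of "1 / q^3"] q by (simp add: jacobi_theta_inverse)
  also have "q * (jacobi_theta Q (q^3) / qpoch_inf Q Q) = jacobi_theta Q q / qpoch_inf Q Q"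
    using jacobi_theta_quasiperiodic[of Q "1 / q"] q jacobi_theta_inverse[of Q q]
    by (simp add: Q_def power_numeral_reduce)
  also have "jacobi_theta Q q = qpoch_inf Q Q ^ 2 / qpoch_inf q q"
    unfolding Q_def by (rule jacobi_theta_square_base_self[OF q])
  finally show ?thesis
    using qpoch_inf_self_nonzero[OF Q(1)]
    by (simp add: Q_def[symmetric] power2_eq_square[of "qpoch_inf _ _"])
qed

subsection \<open>Triple sums\<close>

lemma has_sum_int_nat3_iff:
  fixes c :: "int \<Rightarrow> int \<Rightarrow> int \<Rightarrow> complex"
  shows
    "((\<lambda>(i, j, k). c i j k * (inv_qpoch q i * (inv_qpoch q j * inv_qpoch q k))) has_sum S) UNIV \<longleftrightarrow>
    ((\<lambda>(i, j, k). c (int i) (int j) (int k) / (qpoch q q i * qpoch q q j * qpoch q q k)) has_sum S) UNIV"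
    (is "(?f has_sum S) UNIV \<longleftrightarrow> _")
proof -
  define g where "g = (\<lambda>(i, j, k). (int i, int j, int k))"
  have "inj g" by (auto simp: inj_def g_def)
  have "?f (i, j, k) = 0" if "(i, j, k) \<notin> range g" for i j k
  proof (cases "i < 0 \<or> j < 0 \<or> k < 0")
    case False
    hence "(i, j, k) = g (nat i, nat j, nat k)" by (simp add: g_def)
    with that show ?thesis by blast
  qed auto
  hence "(?f has_sum S) UNIV \<longleftrightarrow> (?f has_sum S) (range g)"
    by (intro has_sum_cong_neutral) auto
  also have "\<dots> \<longleftrightarrow> ((\<lambda>p. ?f (g p)) has_sum S) UNIV"
    by (simp add: has_sum_reindex[OF \<open>inj g\<close>] o_def)
  also have "(\<lambda>p. ?f (g p)) =
      (\<lambda>(i, j, k). c (int i) (int j) (int k) / (qpoch q q i * qpoch q q j * qpoch q q k))"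
    by (auto simp: g_def inv_qpoch_of_nat fun_eq_iff)
  finally show ?thesis .
qed

lemma has_sum_triple_pair_sum:
  assumes q: "norm q < 1" "q \<noteq> 0" and "u \<noteq> 0" "v \<noteq> 0"
  shows "((\<lambda>(i, j, k). q ^ (i^2 + j^2 + k^2 + i * j + i * k) * u ^ (i + k) * v ^ (i + j)
            / (qpoch q q i * qpoch q q j * qpoch q q k)) has_sum pair_sum q u v) UNIV"
proof -
  define c where "c = (\<lambda>(a, b). q powi (a^2 - a * b + b^2) * u powi a * v powi b)"
  define t where "t i j k = q powi (i^2 + j^2 + k^2 + i * j + i * k) * u powi (i + k)
      * v powi (i + j)" for i j k
  have "((\<lambda>p. c p * (inv_qpoch q (fst p) * inv_qpoch q (snd p))) has_sum pair_sum q u v) UNIV"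
    using has_sum_pair_sum[OF assms] by (simp add: c_def pair_term_def case_prod_unfold)
  hence expanded: "((\<lambda>(p, i). c p * vandermonde_term q (fst p) (snd p) i) has_sum
      pair_sum q u v) UNIV"
    by (rule has_sum_vandermonde_expand[OF q])
  have "t i j k * (inv_qpoch q i * (inv_qpoch q j * inv_qpoch q k)) =
      c (i + k, i + j) * vandermonde_term q (i + k) (i + j) i" for i j k
  proof -
    have "q powi (i^2 + j^2 + k^2 + i * j + i * k) =
        q powi ((i + k)^2 - (i + k) * (i + j) + (i + j)^2) * q powi (k * j)"
      using q by (intro power_int_mult_eqI[symmetric]) (auto simp: power2_eq_square algebra_simps)
    thus ?thesis by (simp add: t_def c_def vandermonde_term_def durfee_term_def mult_ac)
  qed
  hence "((\<lambda>(i, j, k). t i j k * (inv_qpoch q i * (inv_qpoch q j * inv_qpoch q k))) has_sum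
      pair_sum q u v) UNIV"
    by (intro has_sum_reindex_UNIV[OF expanded, where j = "\<lambda>(i, j, k). ((i + k, i + j), i)"
          and i = "\<lambda>((a, b), i). (i, b - i, a - i)"]) auto
  moreover have "t (int i) (int j) (int k) =
      q ^ (i^2 + j^2 + k^2 + i * j + i * k) * u ^ (i + k) * v ^ (i + j)" for i j k
    unfolding t_def power_int_of_nat[symmetric] by simp
  ultimately show ?thesis by (simp add: has_sum_int_nat3_iff)
qed

text \<open>Since \<open>2i^2 + 2j^2 + 2k^2 + 2ij + 2ik = (i + j + k)^2 + i^2 + (j - k)^2\<close> and
  \<open>(j - m)^2 + (k - m)^2 = (j - k)^2 + 2 (j - m) (k - m)\<close>, the sum over \<open>m\<close> is q-Vandermonde in
  base \<open>q^2\<close>.\<close>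
lemma has_sum_triple_square_base:
  fixes q :: complex and l :: "int \<Rightarrow> int \<Rightarrow> int \<Rightarrow> int"
  defines "I \<equiv> inv_qpoch (q^2)"
  assumes q: "norm q < 1" "q \<noteq> 0"
    and S: "((\<lambda>((i, j, k), m). q powi ((i + j + k)^2 + i^2 + (j - m)^2 + (k - m)^2 + l i j k)
              * (I i * I m * I (j - m) * I (k - m))) has_sum S) UNIV" (is "(?f has_sum S) _")
  shows "((\<lambda>(i, j, k). q powi (2 * i^2 + 2 * j^2 + 2 * k^2 + 2 * i * j + 2 * i * k + l i j k)
            * (I i * (I j * I k))) has_sum S) UNIV" (is "(?g has_sum S) _")
  using S
proof (rule has_sum_collapse)
  fix p :: "int \<times> int \<times> int"
  obtain i j k where p: "p = (i, j, k)" by (cases p)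
  define t where "t = q powi (2 * i^2 + 2 * j^2 + 2 * k^2 + 2 * i * j + 2 * i * k + l i j k)"
  have summand: "q powi ((i + j + k)^2 + i^2 + (j - m)^2 + (k - m)^2 + l i j k)
      * (I i * I m * I (j - m) * I (k - m)) =
      t * I i * vandermonde_term (q^2) j k m" for m
  proof -
    have base: "(q^2) powi ((j - m) * (k - m)) = q powi (2 * ((j - m) * (k - m)))"
      by (simp only: power_int_mult power_int_numeral)
    have exponent: "q powi ((i + j + k)^2 + i^2 + (j - m)^2 + (k - m)^2 + l i j k) =
        t * q powi (2 * ((j - m) * (k - m)))"
      unfolding t_def using q
      by (intro power_int_mult_eqI[symmetric]) (auto simp: power2_eq_square algebra_simps)
    show ?thesis
      unfolding vandermonde_term_def durfee_term_def I_def base exponent by (simp only: mult_ac)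
  qed
  have "((\<lambda>m. t * I i * vandermonde_term (q^2) j k m) has_sum t * I i * (I j * I k)) UNIV"
    unfolding I_def using q
    by (intro has_sum_cmult_right has_sum_q_vandermonde) (auto simp: norm_power_less_1)
  thus "((\<lambda>m. ?f (p, m)) has_sum ?g p) UNIV"
    by (simp only: p prod.case summand) (simp only: t_def mult.assoc)
qed

definition bressoud_quad_term :: "complex \<Rightarrow> int \<Rightarrow> (int \<times> int) \<times> int \<times> int \<Rightarrow> complex" where
  "bressoud_quad_term q e = (\<lambda>((N, s), p).
     q powi (N^2 + e * N) * q powi (s^2 + e * s) * inv_qpoch (q^2) s * square_base_term q (N - s) p)"

lemma has_sum_bressoud_quad:
  assumes q: "norm q < 1" "q \<noteq> 0" and e: "e = 0 \<or> e = 1"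
  shows "(bressoud_quad_term q e has_sum
      jacobi_theta (q^3) (- (q powi (2 * e))) / qpoch_inf q q) UNIV"
proof -
  define c where "c = (\<lambda>(N, s). q powi (N^2 + e * N) * q powi (s^2 + e * s) * inv_qpoch (q^2) s)"
  have "((\<lambda>x. c x * inv_qpoch q (fst x - snd x)) has_sum
      jacobi_theta (q^3) (- (q powi (2 * e))) / qpoch_inf q q) UNIV"
    using has_sum_bressoud[OF assms] by (simp add: c_def case_prod_unfold)
  from has_sum_square_base_expand[OF q this] show ?thesis
    by (simp add: bressoud_quad_term_def c_def case_prod_unfold)
qed

lemma bressoud_quad_term_eq:
  assumes "q \<noteq> 0"
  shows "bressoud_quad_term q e ((N, s), (m, x)) =
      q powi (N^2 + x^2 + (N - s - 2 * m - x)^2 + s^2 + (e * (N + s) - x))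
        * (inv_qpoch (q^2) x * inv_qpoch (q^2) m * inv_qpoch (q^2) (N - s - 2 * m - x)
           * inv_qpoch (q^2) s)"
proof -
  define y where "y = N - s - 2 * m - x"
  have "N^2 + x^2 + y^2 + s^2 + (e * (N + s) - x) =
      (N^2 + e * N) + (s^2 + e * s) + ((x^2 - x) + y^2)"
    by (simp add: algebra_simps)
  hence "q powi (N^2 + x^2 + y^2 + s^2 + (e * (N + s) - x)) =
      q powi (N^2 + e * N) * q powi (s^2 + e * s) * (q powi (x^2 - x) * q powi (y^2))"
    by (simp only: power_int_add[OF disjI1[OF assms]] mult_ac)
  moreover have "theta_term q 1 y = q powi (y^2)" by (simp add: theta_term_def)
  ultimately show ?thesis
    unfolding bressoud_quad_term_def square_base_term_def prod.case y_def[symmetric]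
    by (simp only: theta_term_inverse_base[OF assms] mult_ac)
qed

subsection \<open>The five identities\<close>

lemma qpoch_base_0 [simp]: "qpoch 0 0 n = 1"
  by (simp add: qpoch_def)

lemma qpoch_inf_base_0 [simp]: "qpoch_inf 0 0 = 1"
  by (simp add: qpoch_inf_def)

lemma qpow_of_nat_add:
  assumes "exp L = q"
  shows "qpow L (real n + \<nu> * (real j - real k)) = q ^ n * qpow L \<nu> ^ j * (1 / qpow L \<nu>) ^ k"
proof -
  have "of_real (real n + \<nu> * (real j - real k)) * L =
      of_nat n * L + of_nat j * (of_real \<nu> * L) - of_nat k * (of_real \<nu> * L)"
    by (simp add: algebra_simps)
  thus ?thesis
    by (simp add: qpow_def exp_add exp_diff exp_of_nat_mult assms power_divide)
qed

lemma has_sum_nahm_jacobi: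
  assumes q: "norm q < 1" "exp L = q"
  shows "((\<lambda>(i,j,k). qpow L (real (i^2 + j^2 + k^2 + i*j + i*k) + \<nu> * (real j - real k))
          / (qpoch q q i * qpoch q q j * qpoch q q k))
       has_sum (qpoch_inf (- qpow L (1 + \<nu>)) (q^2) * qpoch_inf (- qpow L (1 - \<nu>)) (q^2)
                * qpoch_inf (q^2) (q^2) / qpoch_inf q q)) UNIV"
proof -
  define z where "z = qpow L \<nu>"
  have q0: "q \<noteq> 0" using q by auto
  have z: "z \<noteq> 0" by (simp add: z_def qpow_def)
  have "qpow L (1 + \<nu>) = q * z" "qpow L (1 - \<nu>) = q / z"
    using qpow_of_nat_add[OF q(2), of 1 \<nu> 1 0] qpow_of_nat_add[OF q(2), of 1 \<nu> 0 1]
    by (simp_all add: z_def)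
  hence "pair_sum q (1 / z) z =
      qpoch_inf (- qpow L (1 + \<nu>)) (q^2) * qpoch_inf (- qpow L (1 - \<nu>)) (q^2)
      * qpoch_inf (q^2) (q^2) / qpoch_inf q q"
    by (simp add: pair_sum_inverse[OF q(1) q0 z] jacobi_triple_product[OF q(1) q0 z])
  moreover have "(1 / z) ^ (i + k) * z ^ (i + j) = z ^ j * (1 / z) ^ k" for i j k
    using z by (simp add: power_add power_divide)
  ultimately show ?thesis
    using has_sum_triple_pair_sum[OF q(1) q0 _ z, of "1 / z"] z
    by (simp only: qpow_of_nat_add[OF q(2)] z_def[symmetric] mult.assoc) simp
qed

lemma has_sum_nahm_weight_i_j:
  assumes "norm q < 1"
  shows "((\<lambda>(i,j,k). q ^ (i^2 + j^2 + k^2 + i*j + i*k + i + j)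
          / (qpoch q q i * qpoch q q j * qpoch q q k))
       has_sum (qpoch_inf (q^4) (q^4) ^ 2 / (qpoch_inf q q * qpoch_inf (q^2) (q^2)))) UNIV"
proof (cases "q = 0")
  case True
  thus ?thesis
    by (intro has_sum_finite_neutralI[of "{(0, 0, 0)}"]) (auto simp: power_0_left split: if_splits)
next
  case False
  with assms have q: "norm q < 1" "q \<noteq> 0" by simp_all
  show ?thesis
    using has_sum_triple_pair_sum[OF q, of 1 q] q
    by (simp add: pair_sum_one_self[OF q] power_add[symmetric] add.assoc)
qed

lemma has_sum_nahm_weight_i_2k:
  assumes "norm q < 1"
  shows "((\<lambda>(i,j,k). q ^ (2*i^2 + 2*j^2 + 2*k^2 + 2*i*j + 2*i*k + i + 2*k)
          / (qpoch (q^2) (q^2) i * qpoch (q^2) (q^2) j * qpoch (q^2) (q^2) k))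
       has_sum (qpoch_inf q (q^6) * qpoch_inf (q^5) (q^6) * qpoch_inf (q^6) (q^6) / qpoch_inf q q)) UNIV"
proof (cases "q = 0")
  case True
  thus ?thesis
    by (intro has_sum_finite_neutralI[of "{(0, 0, 0)}"]) (auto simp: power_0_left split: if_splits)
next
  case False
  with assms have q: "norm q < 1" "q \<noteq> 0" by simp_all
  define S where "S = qpoch_inf q (q^6) * qpoch_inf (q^5) (q^6) * qpoch_inf (q^6) (q^6)
      / qpoch_inf q q"
  have "q^3 / q^2 = q" using q by (simp add: power_numeral_reduce)
  hence "jacobi_theta (q^3) (- (q powi (2 * 1))) / qpoch_inf q q = S"
    using jacobi_triple_product[of "q^3" "- (q^2)"] q
    by (simp add: S_def norm_power_less_1 power_add[symmetric] mult_ac)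
  hence "(bressoud_quad_term q 1 has_sum S) UNIV" using has_sum_bressoud_quad[OF q, of 1] by simp
  hence "((\<lambda>((i, j, k), m). q powi ((i + j + k)^2 + i^2 + (j - m)^2 + (k - m)^2 + (i + 2 * k))
      * (inv_qpoch (q^2) i * inv_qpoch (q^2) m * inv_qpoch (q^2) (j - m) * inv_qpoch (q^2) (k - m)))
      has_sum S) UNIV"
    by (rule has_sum_reindex_UNIV[where j = "\<lambda>((i, j, k), m). ((i + j + k, k - m), (m, j - m))"
          and i = "\<lambda>((N, s), (m, x)). ((N - s - 2 * m - x, x + m, s + m), m)"])
       (auto simp: bressoud_quad_term_eq[OF q(2)] algebra_simps)
  from has_sum_triple_square_base[OF q this]
  have "((\<lambda>(i, j, k). q powi (2*int i^2 + 2*int j^2 + 2*int k^2 + 2*int i*int j + 2*int i*int k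
            + (int i + 2*int k))
          / (qpoch (q^2) (q^2) i * qpoch (q^2) (q^2) j * qpoch (q^2) (q^2) k)) has_sum S) UNIV"
    by (simp only: has_sum_int_nat3_iff)
  moreover have "q ^ (2*i^2 + 2*j^2 + 2*k^2 + 2*i*j + 2*i*k + i + 2*k) =
      q powi (2*int i^2 + 2*int j^2 + 2*int k^2 + 2*int i*int j + 2*int i*int k + (int i + 2*int k))"
    for i j k
    unfolding power_int_of_nat[symmetric] by (simp add: add.assoc)
  ultimately show ?thesis by (simp add: S_def)
qed

lemma exponent_minus_i_eq_0_iff:
  "2*int i^2 + 2*int j^2 + 2*int k^2 + 2*int i*int j + 2*int i*int k - int i = 0
     \<longleftrightarrow> i = 0 \<and> j = 0 \<and> k = 0"
  (is "?E = 0 \<longleftrightarrow> _")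
proof
  assume "?E = 0"
  have "?E = int i * (2 * int i - 1)
      + (2 * int j^2 + 2 * int k^2 + 2 * int i * int j + 2 * int i * int k)"
    by (simp add: power2_eq_square algebra_simps)
  moreover have "0 \<le> int i * (2 * int i - 1)" by (cases i) auto
  ultimately have "int i * (2 * int i - 1) = 0" "j = 0" "k = 0"
    using \<open>?E = 0\<close> by (auto simp: add_nonneg_eq_0_iff)
  moreover have "2 * int i - 1 \<noteq> 0" by presburger
  ultimately show "i = 0 \<and> j = 0 \<and> k = 0" by simp
qed simp

lemma has_sum_nahm_weight_minus_i:
  assumes "norm q < 1"
  shows "((\<lambda>(i,j,k). q powi (2*int i^2 + 2*int j^2 + 2*int k^2 + 2*int i*int j + 2*int i*int k - int i)
          / (qpoch (q^2) (q^2) i * qpoch (q^2) (q^2) j * qpoch (q^2) (q^2) k))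
       has_sum (qpoch_inf (q^3) (q^3) ^ 2 / (qpoch_inf q q * qpoch_inf (q^6) (q^6)))) UNIV"
proof (cases "q = 0")
  case True
  thus ?thesis
    by (intro has_sum_finite_neutralI[of "{(0, 0, 0)}"])
       (auto simp: exponent_minus_i_eq_0_iff power_int_0_left_if simp del: right_minus_eq
           split: if_splits)
next
  case False
  with assms have q: "norm q < 1" "q \<noteq> 0" by simp_all
  define S where "S = qpoch_inf (q^3) (q^3) ^ 2 / (qpoch_inf q q * qpoch_inf (q^6) (q^6))"
  have "jacobi_theta (q^3) (- (q powi (2 * 0))) / qpoch_inf q q = S"
    using jacobi_theta_minus_1[of "q^3"] q by (simp add: S_def norm_power_less_1)
  hence "(bressoud_quad_term q 0 has_sum S) UNIV" using has_sum_bressoud_quad[OF q, of 0] by simp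
  hence "((\<lambda>((i, j, k), m). q powi ((i + j + k)^2 + i^2 + (j - m)^2 + (k - m)^2 + - i)
      * (inv_qpoch (q^2) i * inv_qpoch (q^2) m * inv_qpoch (q^2) (j - m) * inv_qpoch (q^2) (k - m)))
      has_sum S) UNIV"
    by (rule has_sum_reindex_UNIV[where j = "\<lambda>((i, j, k), m). ((i + j + k, k - m), (m, i))"
          and i = "\<lambda>((N, s), (m, x)). ((x, N - s - m - x, s + m), m)"])
       (auto simp: bressoud_quad_term_eq[OF q(2)])
  from has_sum_triple_square_base[OF q this]
  have "((\<lambda>(i, j, k). q powi (2*int i^2 + 2*int j^2 + 2*int k^2 + 2*int i*int j + 2*int i*int k
            + - int i)
          / (qpoch (q^2) (q^2) i * qpoch (q^2) (q^2) j * qpoch (q^2) (q^2) k)) has_sum S) UNIV"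
    by (simp only: has_sum_int_nat3_iff)
  thus ?thesis by (simp add: S_def)
qed

lemma exponent_minus_2i_j_k_eq_0_iff:
  "2*int i^2 + 2*int j^2 + 2*int k^2 + 2*int i*int j + 2*int i*int k - 2*int i - int j - int k = 0
     \<longleftrightarrow> i \<le> 1 \<and> j = 0 \<and> k = 0" (is "?E = 0 \<longleftrightarrow> _")
proof
  assume "?E = 0"
  have "?E = 2 * (int i * (int i - 1)) + int j * (2 * int j - 1) + int k * (2 * int k - 1)
      + (2 * int i * int j + 2 * int i * int k)"
    by (simp add: power2_eq_square algebra_simps)
  moreover have "0 \<le> int i * (int i - 1)" "0 \<le> int j * (2 * int j - 1)"
    "0 \<le> int k * (2 * int k - 1)"
    by (cases i; cases j; cases k; simp)+
  ultimately have "int i * (int i - 1) = 0" "int j * (2 * int j - 1) = 0"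
    "int k * (2 * int k - 1) = 0"
    using \<open>?E = 0\<close> by (auto simp: add_nonneg_eq_0_iff)
  moreover have "2 * int j - 1 \<noteq> 0" "2 * int k - 1 \<noteq> 0" by presburger+
  ultimately show "i \<le> 1 \<and> j = 0 \<and> k = 0" by auto
qed (auto simp: le_Suc_eq)

lemma has_sum_nahm_weight_minus_2i_j_k:
  assumes "norm q < 1"
  shows "((\<lambda>(i,j,k). q powi (2*int i^2 + 2*int j^2 + 2*int k^2 + 2*int i*int j + 2*int i*int k
                            - 2*int i - int j - int k)
          / (qpoch (q^2) (q^2) i * qpoch (q^2) (q^2) j * qpoch (q^2) (q^2) k))
       has_sum (2 * qpoch_inf (q^2) (q^2) / qpoch_inf q q)) UNIV"
proof (cases "q = 0")
  case True
  thus ?thesis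
    by (intro has_sum_finite_neutralI[of "{(0, 0, 0), (1, 0, 0)}"])
       (auto simp: exponent_minus_2i_j_k_eq_0_iff power_int_0_left_if
             simp del: right_minus_eq split: if_splits)
next
  case False
  with assms have q: "norm q < 1" "q \<noteq> 0" by simp_all
  define Q where "Q = q^2"
  have Q: "norm Q < 1" "Q \<noteq> 0" using q by (auto simp: Q_def norm_power_less_1)
  have "pair_sum Q (1 / q) (1 / q) = 2 * qpoch_inf Q Q / qpoch_inf q q"
    unfolding Q_def by (rule pair_sum_square_base_inverse_inverse[OF q])
  moreover have "Q ^ (i^2 + j^2 + k^2 + i*j + i*k) * (1 / q) ^ (i + k) * (1 / q) ^ (i + j) =
      q powi (2*int i^2 + 2*int j^2 + 2*int k^2 + 2*int i*int j + 2*int i*int k - 2*int i - int j - int k)"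
    for i j k
  proof -
    have "2*int i^2 + 2*int j^2 + 2*int k^2 + 2*int i*int j
        + 2*int i*int k - 2*int i - int j - int k =
        int (2 * (i^2 + j^2 + k^2 + i*j + i*k)) - int (i + k) - int (i + j)"
      by simp
    thus ?thesis
      using q by (simp only: power_int_diff[OF disjI1[OF q(2)]] power_int_of_nat)
        (simp only: Q_def power_mult power_divide power_one times_divide_eq_right mult_1_right)
  qed
  ultimately show ?thesis
    using has_sum_triple_pair_sum[OF Q, of "1 / q" "1 / q"] q by (simp only:) (simp add: Q_def)
qed

theorem theorem4p7:
  fixes q :: complex
  assumes "norm q < 1"
  shows
   "(\<forall>L (\<nu>::real). exp L = q \<longrightarrow>
      ((\<lambda>(i,j,k). qpow L (real (i^2 + j^2 + k^2 + i*j + i*k) + \<nu> * (real j - real k))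
          / (qpoch q q i * qpoch q q j * qpoch q q k))
       has_sum (qpoch_inf (- qpow L (1 + \<nu>)) (q^2) * qpoch_inf (- qpow L (1 - \<nu>)) (q^2)
                * qpoch_inf (q^2) (q^2) / qpoch_inf q q)) (UNIV :: (nat \<times> nat \<times> nat) set))
    \<and> ((\<lambda>(i,j,k). q ^ (i^2 + j^2 + k^2 + i*j + i*k + i + j)
          / (qpoch q q i * qpoch q q j * qpoch q q k))
       has_sum (qpoch_inf (q^4) (q^4) ^ 2 / (qpoch_inf q q * qpoch_inf (q^2) (q^2))))
       (UNIV :: (nat \<times> nat \<times> nat) set)
    \<and> ((\<lambda>(i,j,k). q ^ (2*i^2 + 2*j^2 + 2*k^2 + 2*i*j + 2*i*k + i + 2*k)
          / (qpoch (q^2) (q^2) i * qpoch (q^2) (q^2) j * qpoch (q^2) (q^2) k))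
       has_sum (qpoch_inf q (q^6) * qpoch_inf (q^5) (q^6) * qpoch_inf (q^6) (q^6) / qpoch_inf q q))
       (UNIV :: (nat \<times> nat \<times> nat) set)
    \<and> ((\<lambda>(i,j,k). q powi (2*int i^2 + 2*int j^2 + 2*int k^2 + 2*int i*int j + 2*int i*int k - int i)
          / (qpoch (q^2) (q^2) i * qpoch (q^2) (q^2) j * qpoch (q^2) (q^2) k))
       has_sum (qpoch_inf (q^3) (q^3) ^ 2 / (qpoch_inf q q * qpoch_inf (q^6) (q^6))))
       (UNIV :: (nat \<times> nat \<times> nat) set)
    \<and> ((\<lambda>(i,j,k). q powi (2*int i^2 + 2*int j^2 + 2*int k^2 + 2*int i*int j + 2*int i*int k
                            - 2*int i - int j - int k)
          / (qpoch (q^2) (q^2) i * qpoch (q^2) (q^2) j * qpoch (q^2) (q^2) k))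
       has_sum (2 * qpoch_inf (q^2) (q^2) / qpoch_inf q q))
       (UNIV :: (nat \<times> nat \<times> nat) set)"
  using assms
  by (intro conjI allI impI has_sum_nahm_jacobi has_sum_nahm_weight_i_j has_sum_nahm_weight_i_2k
        has_sum_nahm_weight_minus_i has_sum_nahm_weight_minus_2i_j_k)

end
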